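(* Let $p\in\{0,1,\ldots,6\}$ and let $f_0:\mathbb{R}^{p+1}\to\mathbb{O}$ be a polynomial. Then $CK[f_0]$ is the unique extension of $f_0$ to $\mathbb{O}$ which is (left) generalized partial-slice monogenic of type $p$.
   Context: $\mathbb{O}$ is the real, non-associative, alternative algebra of octonions with basis $e_0=1,e_1,\ldots,e_7$ and product $e_ie_j=-\delta_{ij}+\sum_k\epsilon_{ijk}e_k$ for $1\le i,j\le 7$, where $\epsilon_{ijk}$ is totally antisymmetric, equals $1$ on the triples $(1,2,3),(1,4,5),(2,4,6),(3,4,7),(5,3,6),(6,1,7),(7,2,5)$, and vanishes on triples that are not permutations of these. $\mathbb{O}$ is identified with $\mathbb{R}^8$. Fix $p\in\{0,\ldots,6\}$. $\mathbb{R}^{p+1}$ denotes the real span of $e_0,\ldots,e_p$, with elements $\boldsymbol{x}_p=\sum_{i=0}^px_ie_i$, and $\mathbb{S}=\{\sum_{i=p+1}^7x_ie_i:\sum_{i=p+1}^7x_i^2=1\}$. For $\Omega\subseteq\mathbb{O}$ open and $\underline{\omega}\in\mathbb{S}$, $\Omega_{\underline{\omega}}=\Omega\cap(\mathbb{R}^{p+1}\oplus\underline{\omega}\mathbb{R})$ is viewed as an open subset of $\mathbb{R}^{p+2}$ with coordinates $(x_0,\ldots,x_p,r)\leftrightarrow\boldsymbol{x}_p+r\underline{\omega}$. A function $f:\Omega\to\mathbb{O}$ on a domain $\Omega$ is (left) generalized partial-slice monogenic of type $p$ if, for every $\underline{\omega}\in\mathbb{S}$, the restriction $f_{\underline{\omega}}$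 to $\Omega_{\underline{\omega}}$ is of class $C^1$ and satisfies $\sum_{i=0}^pe_i\,\partial_{x_i}f_{\underline{\omega}}+\underline{\omega}\,\partial_rf_{\underline{\omega}}=0$ on $\Omega_{\underline{\omega}}$. A polynomial $f_0:\mathbb{R}^{p+1}\to\mathbb{O}$ is a function whose eight real components are polynomials in $x_0,\ldots,x_p$. With $D_{\boldsymbol{x}_p}=\sum_{i=0}^pe_i\partial_{x_i}$ (acting by left multiplication) and $\Delta_{\boldsymbol{x}_p}=\sum_{i=0}^p\partial_{x_i}^2$, the CK-extension $CK[f_0]:\mathbb{O}\to\mathbb{O}$ is $$CK[f_0](\boldsymbol{x})=\sum_{k=0}^{+\infty}\frac{r^{2k}}{(2k)!}(-\Delta_{\boldsymbol{x}_p})^kf_0(\boldsymbol{x}_p)+\underline{\omega}\sum_{k=0}^{+\infty}\frac{r^{2k+1}}{(2k+1)!}(-\Delta_{\boldsymbol{x}_p})^k\big(D_{\boldsymbol{x}_p}f_0(\boldsymbol{x}_p)\big),$$ for $\boldsymbol{x}=\boldsymbol{x}_p+r\underline{\omega}$ with $\boldsymbol{x}_p\in\mathbb{R}^{p+1}$, $r\ge0$, $\underline{\omega}\in\mathbb{S}$ (the sums are finite, and for $r=0$ the value does not depend on $\underline{\omega}$). *)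

theory Defs
  imports "HOL-Analysis.Analysis"
begin

section \<open>Octonions\<close>

text \<open>The octonions are the Euclidean space of dimension 8. The index type \<open>8\<close> consists of the
  residues modulo 8, and \<^term>\<open>of_nat :: nat \<Rightarrow> 8\<close> is a bijection from \<open>{0..7}\<close> onto it, so the
  basis elements and coordinates are indexed by natural numbers below 8. The componentwise product
  that the library puts on this type is not used.\<close>

type_synonym octonion = "real ^ 8"

definition \<e> :: "nat \<Rightarrow> octonion" where
  "\<e> i = axis (of_nat i) 1"

definition crd :: "octonion \<Rightarrow> nat \<Rightarrow> real" where
  "crd x i = x $ of_nat i"

definition fano :: "(nat \<times> nat \<times> nat) set" where
  "fano = {(1,2,3), (1,4,5), (2,4,6), (3,4,7), (5,3,6), (6,1,7), (7,2,5)}"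

text \<open>Totally antisymmetric: 1 on the even and -1 on the odd permutations of the listed triples.\<close>

definition eps :: "nat \<Rightarrow> nat \<Rightarrow> nat \<Rightarrow> real" where
  "eps i j k =
    (if (i,j,k) \<in> fano \<or> (j,k,i) \<in> fano \<or> (k,i,j) \<in> fano then 1
     else if (j,i,k) \<in> fano \<or> (i,k,j) \<in> fano \<or> (k,j,i) \<in> fano then -1
     else 0)"

definition basis_mult :: "nat \<Rightarrow> nat \<Rightarrow> octonion" where
  "basis_mult i j =
    (if i = 0 then \<e> j
     else if j = 0 then \<e> i
     else (if i = j then - \<e> 0 else 0) + (\<Sum>k=1..7. eps i j k *\<^sub>R \<e> k))"

definition oct_mult :: "octonion \<Rightarrow> octonion \<Rightarrow> octonion"  (infix \<open>\<odot>\<close> 70) where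
  "x \<odot> y = (\<Sum>i\<le>7. \<Sum>j\<le>7. (crd x i * crd y j) *\<^sub>R basis_mult i j)"


section \<open>Partial slices\<close>

definition paravec :: "nat \<Rightarrow> octonion set" where
  "paravec p = span (\<e> ` {..p})"

definition slice_sphere :: "nat \<Rightarrow> octonion set" where
  "slice_sphere p = {\<Sum>i=p+1..7. x i *\<^sub>R \<e> i | x. (\<Sum>i=p+1..7. (x i)\<^sup>2) = (1::real)}"

definition slice_space :: "nat \<Rightarrow> octonion \<Rightarrow> octonion set" where
  "slice_space p \<omega> = {xp + r *\<^sub>R \<omega> | xp r. xp \<in> paravec p}"

text \<open>Directional derivative, which is meaningful when the function is differentiable along the
  line. Since \<open>(x\<^sub>0,\<dots>,x\<^sub>p,r)\<close> are the coordinates of \<open>x\<^sub>p + r \<omega>\<close>, the partial derivative with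
  respect to \<open>x\<^sub>i\<close> is the one along \<open>\<e> i\<close> and the one with respect to \<open>r\<close> is the one along \<open>\<omega>\<close>;
  at points of a subspace that contains the direction, only the values on that subspace matter.\<close>

definition dir_deriv :: "octonion \<Rightarrow> (octonion \<Rightarrow> octonion) \<Rightarrow> octonion \<Rightarrow> octonion" where
  "dir_deriv v f x = vector_derivative (\<lambda>t. f (x + t *\<^sub>R v)) (at 0)"

text \<open>Class \<open>C\<^sup>1\<close> for the restriction to a slice (relatively open in the slice space): all first
  partial derivatives in the coordinates \<open>(x\<^sub>0,\<dots>,x\<^sub>p,r)\<close> exist and are continuous.\<close>

definition C1_on_slice :: "nat \<Rightarrow> octonion \<Rightarrow> octonion set \<Rightarrow> (octonion \<Rightarrow> octonion) \<Rightarrow> bool" where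
  "C1_on_slice p \<omega> U f \<longleftrightarrow>
    (\<forall>v \<in> insert \<omega> (\<e> ` {..p}).
       (\<forall>x\<in>U. (\<lambda>t. f (x + t *\<^sub>R v)) differentiable (at (0::real))) \<and>
       continuous_on U (dir_deriv v f))"

definition slice_monogenic :: "nat \<Rightarrow> octonion set \<Rightarrow> (octonion \<Rightarrow> octonion) \<Rightarrow> bool" where
  "slice_monogenic p \<Omega> f \<longleftrightarrow>
    open \<Omega> \<and> connected \<Omega> \<and>
    (\<forall>\<omega>\<in>slice_sphere p.
       C1_on_slice p \<omega> (\<Omega> \<inter> slice_space p \<omega>) f \<and>
       (\<forall>x\<in>\<Omega> \<inter> slice_space p \<omega>.
          (\<Sum>i\<le>p. \<e> i \<odot> dir_deriv (\<e> i) f x) + (\<omega> \<odot> dir_deriv \<omega> f x) = 0))"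


section \<open>Polynomials and the CK-extension\<close>

text \<open>Functions on \<^term>\<open>paravec p\<close> are represented by functions on all octonions of which only the
  values on \<^term>\<open>paravec p\<close> matter. A finite set \<open>A\<close> of multi-indices and coefficients \<open>c\<close> describe
  a polynomial in \<open>x\<^sub>0,\<dots>,x\<^sub>p\<close>.\<close>

definition oct_polynomial :: "nat \<Rightarrow> (octonion \<Rightarrow> octonion) \<Rightarrow> bool" where
  "oct_polynomial p f \<longleftrightarrow>
    (\<forall>j\<le>7. \<exists>(A :: (nat \<Rightarrow> nat) set) c. finite A \<and>
       (\<forall>x\<in>paravec p. crd (f x) j = (\<Sum>\<alpha>\<in>A. c \<alpha> * (\<Prod>i\<le>p. crd x i ^ \<alpha> i))))"

definition para_Dirac :: "nat \<Rightarrow> (octonion \<Rightarrow> octonion) \<Rightarrow> octonion \<Rightarrow> octonion" where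
  "para_Dirac p f x = (\<Sum>i\<le>p. \<e> i \<odot> dir_deriv (\<e> i) f x)"

definition neg_Laplacian :: "nat \<Rightarrow> (octonion \<Rightarrow> octonion) \<Rightarrow> octonion \<Rightarrow> octonion" where
  "neg_Laplacian p f x = - (\<Sum>i\<le>p. dir_deriv (\<e> i) (dir_deriv (\<e> i) f) x)"

definition CK_series ::
    "nat \<Rightarrow> (octonion \<Rightarrow> octonion) \<Rightarrow> octonion \<Rightarrow> real \<Rightarrow> octonion \<Rightarrow> octonion" where
  "CK_series p f0 xp r \<omega> =
     (\<Sum>k. (r ^ (2*k) / fact (2*k)) *\<^sub>R (neg_Laplacian p ^^ k) f0 xp) +
     (\<omega> \<odot> (\<Sum>k. (r ^ (2*k+1) / fact (2*k+1)) *\<^sub>R (neg_Laplacian p ^^ k) (para_Dirac p f0) xp))"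

definition para_part :: "nat \<Rightarrow> octonion \<Rightarrow> octonion" where
  "para_part p x = (\<Sum>i\<le>p. crd x i *\<^sub>R \<e> i)"

text \<open>For \<open>x = x\<^sub>p + r \<omega>\<close> with \<open>r \<ge> 0\<close> and \<open>\<omega>\<close> in the sphere, \<open>r\<close> is the norm of \<open>x - x\<^sub>p\<close>, and
  \<open>\<omega>\<close> is its normalization if \<open>r > 0\<close>. For \<open>r = 0\<close> the second summand vanishes, and the value
  \<open>sgn 0 = 0\<close> is harmless. The lemma \<open>CK_eq\<close> below is the defining formula for every admissible
  decomposition.\<close>

definition CK :: "nat \<Rightarrow> (octonion \<Rightarrow> octonion) \<Rightarrow> octonion \<Rightarrow> octonion" where
  "CK p f0 x = CK_series p f0 (para_part p x) (norm (x - para_part p x)) (sgn (x - para_part p x))"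

lemma of_nat_8_eq_iff:
  assumes "i < 8" "j < 8"
  shows "(of_nat i :: 8) = of_nat j \<longleftrightarrow> i = j"
proof -
  have "i \<in> {0,1,2,3,4,5,6,7}" "j \<in> {0,1,2,3,4,5,6,7}" using assms by auto
  then show ?thesis by auto
qed

lemma crd_e: "i < 8 \<Longrightarrow> j < 8 \<Longrightarrow> crd (\<e> i) j = (if i = j then 1 else 0)"
  by (auto simp: crd_def \<e>_def axis_def of_nat_8_eq_iff)

lemma crd_add: "crd (x + y) i = crd x i + crd y i"
  by (simp add: crd_def)

lemma crd_scaleR: "crd (c *\<^sub>R x) i = c * crd x i"
  by (simp add: crd_def)

lemma crd_sum: "crd (\<Sum>a\<in>A. f a) i = (\<Sum>a\<in>A. crd (f a) i)"
  by (induction A rule: infinite_finite_induct) (auto simp: crd_add, auto simp: crd_def)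

lemma para_part_paravec:
  assumes p: "p \<le> 6" and x: "x \<in> paravec p"
  shows "para_part p x = x"
  using x unfolding paravec_def
proof (induction rule: span_induct_alt)
  case base
  show ?case by (simp add: para_part_def crd_def)
next
  case (step c x y)
  then obtain j where j: "j \<le> p" "x = \<e> j" by auto
  have "para_part p (c *\<^sub>R x + y) = c *\<^sub>R para_part p x + para_part p y"
    by (simp add: para_part_def crd_add crd_scaleR scaleR_add_left sum.distrib scaleR_sum_right)
  moreover have "para_part p x = (\<Sum>i\<le>p. if i = j then \<e> i else 0)"
    unfolding para_part_def j(2) using j(1) p by (intro sum.cong) (auto simp: crd_e)
  ultimately show ?case using step j by simp
qed

lemma CK_eq:
  assumes p: "p \<le> 6" and xp: "xp \<in> paravec p" and r: "r \<ge> 0" and \<omega>: "\<omega> \<in> slice_sphere p"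
  shows "CK p f0 (xp + r *\<^sub>R \<omega>) = CK_series p f0 xp r \<omega>"
proof -
  obtain a where a: "\<omega> = (\<Sum>i=p+1..7. a i *\<^sub>R \<e> i)" "(\<Sum>i=p+1..7. (a i)\<^sup>2) = (1::real)"
    using \<omega> unfolding slice_sphere_def by auto
  have "crd \<omega> i = 0" if "i \<le> p" for i
    unfolding a crd_sum crd_scaleR using that p by (intro sum.neutral) (auto simp: crd_e)
  then have *: "para_part p (xp + r *\<^sub>R \<omega>) = xp"
    using para_part_paravec[OF p xp] by (simp add: para_part_def crd_add crd_scaleR)
  have e: "\<e> i \<bullet> \<e> j = (if i = j then 1 else 0)" if "i < 8" "j < 8" for i j
    using that by (auto simp: \<e>_def inner_axis_axis of_nat_8_eq_iff)
  have "\<omega> \<bullet> \<omega> = (\<Sum>i=p+1..7. \<Sum>j=p+1..7. (a i * a j) * (\<e> i \<bullet> \<e> j))"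
    by (simp add: a inner_sum_left inner_sum_right sum_distrib_left mult_ac inner_commute)
  also have "\<dots> = (\<Sum>i=p+1..7. \<Sum>j=p+1..7. if i = j then (a i)\<^sup>2 else 0)"
    by (intro sum.cong refl) (auto simp: e power2_eq_square)
  also have "\<dots> = 1" using a(2) by simp
  finally have n: "norm \<omega> = 1" by (simp add: norm_eq_1)
  show ?thesis
  proof (cases "r = 0")
    case True
    have z: "x \<odot> 0 = 0" for x by (simp add: oct_mult_def crd_def)
    show ?thesis unfolding CK_def * by (simp add: CK_series_def True z)
  next
    case False
    then have "sgn (r *\<^sub>R \<omega>) = \<omega>" using r n by (simp add: sgn_div_norm)
    then show ?thesis unfolding CK_def * using r n by simp
  qed
qed

end

theory Submission
  imports Defs
begin

text \<open>
  Existence is a computation. For a polynomial \<open>f\<close> the restriction of the CK-extension to the slice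
  of \<open>\<omega>\<close> is \<open>\<Sum>n. (r ^ n / n!) c\<^sub>n\<close>, where \<open>c\<^sub>n\<close> is \<open>(- \<Delta>)\<^sup>k f\<close> for \<open>n = 2 k\<close> and
  \<open>\<omega> (- \<Delta>)\<^sup>k D f\<close> for \<open>n = 2 k + 1\<close>; since replacing \<open>(r, \<omega>)\<close> by \<open>(- r, - \<omega>)\<close> changes nothing,
  this holds for both signs of \<open>r\<close>. Differentiation with respect to \<open>r\<close> shifts the sequence, so
  monogenicity amounts to the recursion \<open>D c\<^sub>n + \<omega> c\<^sub>n\<^sub>+\<^sub>1 = 0\<close> (lemma \<open>CK_coeff_recursion\<close>). The
  recursion uses only three consequences of alternativity: \<open>\<omega> (\<omega> y) = - y\<close>, \<open>e\<^sub>i (\<omega> y) = \<omega> (conj e\<^sub>i y)\<close>,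
  and that the conjugate Dirac operator composed with \<open>D\<close> is \<open>\<Delta>\<close>. All of them are instances of the
  polarized identity \<open>conj u (w y) + conj w (u y) = 2 \<langle>u, w\<rangle> y\<close> (lemma \<open>oct_conj_mult_polar\<close>).

  Uniqueness is a Cauchy problem on each slice: the difference \<open>h\<close> of two extensions is of class
  \<open>C\<^sup>1\<close>, satisfies the Dirac equation and vanishes for \<open>r = 0\<close>. The equation forces all first partial
  derivatives of \<open>h\<close> to vanish there too, hence \<open>h\<close> restricted to \<open>r \<ge> 0\<close> and continued by zero is
  again a \<open>C\<^sup>1\<close> solution, now on the whole space and vanishing on a half-space. Averaging over boxes makes
  it smooth enough to apply the conjugate operator, which shows that its components are harmonic.
  A harmonic function \<open>u\<close> that vanishes on a half-space is zero (lemma \<open>harmonic_unique_continuation\<close>):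
  the maximum principle on a half-ball, applied to the odd part of \<open>u\<close> in the normal direction and a quadratic
  barrier, bounds one increment \<open>u (x + h v) - u x\<close> by a constant times \<open>h / R\<close> times the maximum of
  \<open>\<bar>u\<bar>\<close> on a ball of radius \<open>R\<close>. Iteration bounds increments of high order, and Newton's forward difference
  formula, started deep enough in the half-space that all increments of low order are zero, gives \<open>u x = 0\<close>
  when the step tends to zero. The radius \<open>R\<close> can be taken as large as needed because \<open>u\<close> is defined
  everywhere.

  The Cauchy problem is treated for arbitrary families of linear maps satisfying the Clifford relations
  on a Euclidean space (lemma \<open>Dirac_Cauchy_uniqueness\<close>); left multiplications by octonions and by
  their conjugates are such families in spite of the missing associativity.
\<close>

section \<open>Directional derivatives\<close>

text \<open>The derivative is required on every line in direction \<open>b\<close>. Working with functions on the whole space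
  and with derivatives only in the directions of an orthonormal set keeps the dimension of the slices out
  of the types: a function on a slice becomes a function on the whole space by composition with the
  orthogonal projection.\<close>

definition has_dd :: "('a::real_normed_vector \<Rightarrow> 'b::real_normed_vector) \<Rightarrow> 'a \<Rightarrow> ('a \<Rightarrow> 'b) \<Rightarrow> bool" where
  "has_dd f b f' \<longleftrightarrow> (\<forall>x. ((\<lambda>t. f (x + t *\<^sub>R b)) has_vector_derivative f' x) (at 0))"

lemma has_ddI: "(\<And>x. ((\<lambda>t. f (x + t *\<^sub>R b)) has_vector_derivative f' x) (at 0)) \<Longrightarrow> has_dd f b f'"
  by (simp add: has_dd_def)

lemma has_ddD: "has_dd f b f' \<Longrightarrow> ((\<lambda>t. f (x + t *\<^sub>R b)) has_vector_derivative f' x) (at 0)"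
  by (simp add: has_dd_def)

lemma has_dd_at:
  assumes "has_dd f b f'"
  shows "((\<lambda>t. f (x + t *\<^sub>R b)) has_vector_derivative f' (x + t *\<^sub>R b)) (at t)"
proof -
  have 1: "((\<lambda>s. s - t) has_vector_derivative 1) (at t)"
    by (auto intro!: derivative_eq_intros)
  have 2: "((\<lambda>s. f ((x + t *\<^sub>R b) + s *\<^sub>R b)) has_vector_derivative f' (x + t *\<^sub>R b)) (at (t - t))"
    using has_ddD[OF assms] by simp
  from vector_diff_chain_at[OF 1 2] show ?thesis
    by (simp add: o_def algebra_simps)
qed

lemma has_dd_unique: "has_dd f b f' \<Longrightarrow> has_dd f b f'' \<Longrightarrow> f' = f''"
  unfolding has_dd_def by (auto intro: vector_derivative_unique_at)

lemma has_dd_diff: "has_dd f b f' \<Longrightarrow> has_dd g b g' \<Longrightarrow> has_dd (\<lambda>x. f x - g x) b (\<lambda>x. f' x - g' x)"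
  unfolding has_dd_def by (auto intro: has_vector_derivative_diff)

lemma has_dd_linear: "bounded_linear L \<Longrightarrow> has_dd f b f' \<Longrightarrow> has_dd (\<lambda>x. L (f x)) b (\<lambda>x. L (f' x))"
  unfolding has_dd_def by (auto intro: bounded_linear.has_vector_derivative)

lemma has_dd_sum:
  "(\<And>i. i \<in> I \<Longrightarrow> has_dd (f i) b (f' i)) \<Longrightarrow> has_dd (\<lambda>x. \<Sum>i\<in>I. f i x) b (\<lambda>x. \<Sum>i\<in>I. f' i x)"
  unfolding has_dd_def by (auto intro: has_vector_derivative_sum)

lemma has_dd_shift: "has_dd f b f' \<Longrightarrow> has_dd (\<lambda>x. f (x + w)) b (\<lambda>x. f' (x + w))"
  unfolding has_dd_def
proof
  fix x assume "\<forall>x. ((\<lambda>t. f (x + t *\<^sub>R b)) has_vector_derivative f' x) (at 0)"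
  from this[rule_format, of "x + w"]
  show "((\<lambda>t. f (x + t *\<^sub>R b + w)) has_vector_derivative f' (x + w)) (at 0)"
    by (simp add: algebra_simps)
qed

section \<open>Harmonic functions vanishing on a half-space\<close>

lemma no_local_max_if_second_deriv_pos:
  fixes \<phi> :: "real \<Rightarrow> real"
  assumes d1: "\<And>t. (\<phi> has_real_derivative \<phi>' t) (at t)"
    and d2: "(\<phi>' has_real_derivative l) (at 0)" and l: "l > 0"
    and "\<delta> > 0" and max: "\<And>t. \<bar>t\<bar> < \<delta> \<Longrightarrow> \<phi> t \<le> \<phi> 0"
  shows False
proof -
  have 0: "\<phi>' 0 = 0"
    using DERIV_local_max[OF d1 \<open>\<delta> > 0\<close>] max by auto
  obtain d where d: "d > 0" "\<And>h. 0 < h \<Longrightarrow> h < d \<Longrightarrow> \<phi>' 0 < \<phi>' h"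
    using DERIV_pos_inc_right[OF d2 l] by auto
  define h where "h = min d \<delta> / 2"
  have h: "0 < h" "h < d" "h < \<delta>" using d \<open>\<delta> > 0\<close> by (auto simp: h_def)
  have "\<exists>z>0. z < h \<and> \<phi> h - \<phi> 0 = (h - 0) * \<phi>' z"
    by (intro MVT2) (use h d1 in auto)
  then obtain z where z: "0 < z" "z < h" "\<phi> h - \<phi> 0 = h * \<phi>' z" by auto
  have "\<phi>' z > 0" using d(2)[of z] z h 0 by auto
  then have "\<phi> h > \<phi> 0" using z h by (metis diff_gt_0_iff_gt mult_pos_pos)
  with max[of h] h show False by auto
qed

text \<open>At a maximum point outside \<open>S\<close> none of the second derivatives could be positive, although their sum is.\<close>

lemma strict_max_principle:
  fixes w :: "'a::real_normed_vector \<Rightarrow> real"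
  assumes K: "compact K" and w: "continuous_on K w"
    and bd: "\<And>x. x \<in> K \<Longrightarrow> x \<in> S \<Longrightarrow> w x \<le> 0"
    and int: "\<And>x b. x \<in> K \<Longrightarrow> x \<notin> S \<Longrightarrow> b \<in> B \<Longrightarrow> \<exists>\<delta>>0. \<forall>t. \<bar>t\<bar> < \<delta> \<longrightarrow> x + t *\<^sub>R b \<in> K"
    and w1: "\<And>b. b \<in> B \<Longrightarrow> has_dd w b (w1 b)"
    and w2: "\<And>b. b \<in> B \<Longrightarrow> has_dd (w1 b) b (w2 b)"
    and pos: "\<And>x. (\<Sum>b\<in>B. w2 b x) > 0" and x: "x \<in> K"
  shows "w x \<le> 0"
proof -
  obtain m where m: "m \<in> K" "\<And>y. y \<in> K \<Longrightarrow> w y \<le> w m"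
    using continuous_attains_sup[OF K _ w] x by blast
  have "m \<in> S"
  proof (rule ccontr)
    assume "m \<notin> S"
    obtain b where b: "b \<in> B" "w2 b m > 0"
      using pos[of m] by (meson not_le sum_nonpos)
    obtain \<delta> where \<delta>: "\<delta> > 0" "\<And>t. \<bar>t\<bar> < \<delta> \<Longrightarrow> m + t *\<^sub>R b \<in> K"
      using int[OF m(1) \<open>m \<notin> S\<close> b(1)] by auto
    show False
    proof (rule no_local_max_if_second_deriv_pos[where \<delta> = \<delta>])
      show "((\<lambda>t. w (m + t *\<^sub>R b)) has_real_derivative w1 b (m + t *\<^sub>R b)) (at t)" for t
        using has_dd_at[OF w1[OF b(1)]] by (simp add: has_real_derivative_iff_has_vector_derivative)
      show "((\<lambda>t. w1 b (m + t *\<^sub>R b)) has_real_derivative w2 b m) (at 0)"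
        using has_ddD[OF w2[OF b(1)]] by (simp add: has_real_derivative_iff_has_vector_derivative)
    qed (use b(2) \<delta> m(2) in simp_all)
  qed
  then show ?thesis using bd[OF m(1)] m(2)[OF x] by auto
qed

definition orthonormal :: "'a::real_inner set \<Rightarrow> bool" where
  "orthonormal B \<longleftrightarrow> finite B \<and> (\<forall>b\<in>B. \<forall>c\<in>B. b \<bullet> c = (if b = c then 1 else 0))"

definition harmonic :: "'a::real_normed_vector set \<Rightarrow> ('a \<Rightarrow> real) \<Rightarrow> bool" where
  "harmonic B u \<longleftrightarrow> continuous_on UNIV u \<and>
     (\<exists>u1 u2. (\<forall>b\<in>B. has_dd u b (u1 b) \<and> has_dd (u1 b) b (u2 b)) \<and> (\<forall>x. (\<Sum>b\<in>B. u2 b x) = 0))"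

lemma harmonicI:
  assumes "continuous_on UNIV u" "\<And>b. b \<in> B \<Longrightarrow> has_dd u b (u1 b)"
    "\<And>b. b \<in> B \<Longrightarrow> has_dd (u1 b) b (u2 b)" "\<And>x. (\<Sum>b\<in>B. u2 b x) = 0"
  shows "harmonic B u"
  using assms unfolding harmonic_def by blast

lemma harmonic_shift: 
  assumes "harmonic B u" shows "harmonic B (\<lambda>x. u (x + w))"
proof -
  obtain u1 u2 where u: "continuous_on UNIV u" "\<forall>b\<in>B. has_dd u b (u1 b) \<and> has_dd (u1 b) b (u2 b)" "\<forall>x. (\<Sum>b\<in>B. u2 b x) = 0"
    using assms unfolding harmonic_def by auto
  then show ?thesis
    unfolding harmonic_def
    by (intro conjI exI[of _ "\<lambda>b x. u1 b (x + w)"] exI[of _ "\<lambda>b x. u2 b (x + w)"])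
      (auto intro!: has_dd_shift continuous_on_compose2[OF u(1)] continuous_intros)
qed

lemma harmonic_diff: 
  assumes "harmonic B u" "harmonic B v" shows "harmonic B (\<lambda>x. u x - v x)"
proof -
  obtain u1 u2 where u: "continuous_on UNIV u" "\<forall>b\<in>B. has_dd u b (u1 b) \<and> has_dd (u1 b) b (u2 b)" "\<forall>x. (\<Sum>b\<in>B. u2 b x) = 0"
    using assms unfolding harmonic_def by auto
  obtain v1 v2 where v: "continuous_on UNIV v" "\<forall>b\<in>B. has_dd v b (v1 b) \<and> has_dd (v1 b) b (v2 b)" "\<forall>x. (\<Sum>b\<in>B. v2 b x) = 0"
    using assms unfolding harmonic_def by auto
  show ?thesis
    unfolding harmonic_def using u v
    by (intro conjI exI[of _ "\<lambda>b x. u1 b x - v1 b x"] exI[of _ "\<lambda>b x. u2 b x - v2 b x"])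
      (auto intro!: has_dd_diff continuous_intros simp: sum_subtractf)
qed

lemma harmonic_uminus: 
  assumes "harmonic B u" shows "harmonic B (\<lambda>x. - u x)"
proof -
  have "harmonic B (\<lambda>x. 0)"
    unfolding harmonic_def by (intro conjI exI[of _ "\<lambda>b x. 0"]) (auto simp: has_dd_def)
  from harmonic_diff[OF this assms] show ?thesis by simp
qed

text \<open>For the half-ball \<open>norm y \<le> R\<close>, \<open>y \<bullet> v \<ge> 0\<close>: on the spherical part of its boundary the function is at
  least \<open>R\<^sup>2\<close>, on the flat part it is nonnegative, on the axis it is of order \<open>R * (y \<bullet> v)\<close>, and its
  Laplacian in \<open>n\<close> variables is \<open>2 * n - 2 * N\<close>.\<close>

definition barrier :: "real \<Rightarrow> real \<Rightarrow> 'a::real_inner \<Rightarrow> 'a \<Rightarrow> real" where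
  "barrier N R v y = y \<bullet> y - N * (y \<bullet> v)\<^sup>2 + N * R * (y \<bullet> v)"

lemma has_dd_barrier:
  "has_dd (barrier N R v) b (\<lambda>y. 2 * (y \<bullet> b) - 2 * N * (y \<bullet> v) * (b \<bullet> v) + N * R * (b \<bullet> v))"
  unfolding barrier_def has_dd_def has_real_derivative_iff_has_vector_derivative[symmetric]
  by (auto intro!: derivative_eq_intros simp: algebra_simps inner_commute power2_eq_square inner_add_left inner_add_right)

lemma has_dd_barrier':
  "has_dd (\<lambda>y. 2 * (y \<bullet> b) - 2 * N * (y \<bullet> v) * (b \<bullet> v) + N * R * (b \<bullet> v)) b 
    (\<lambda>y. 2 * (b \<bullet> b) - 2 * N * (b \<bullet> v)\<^sup>2)"
  unfolding has_dd_def has_real_derivative_iff_has_vector_derivative[symmetric]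
  by (auto intro!: derivative_eq_intros simp: algebra_simps inner_commute power2_eq_square inner_add_left inner_add_right)

text \<open>The reflection in the hyperplane orthogonal to \<open>v\<close> fixes the other directions of \<open>B\<close> and reverses \<open>v\<close>.
  Applying this twice shows that it preserves harmonicity.\<close>

lemma has_dd_reflect:
  assumes "orthonormal B" "v \<in> B" "b \<in> B" "has_dd u b u1"
  shows "has_dd (\<lambda>y. u (x + (y - (2 * (y \<bullet> v)) *\<^sub>R v))) b 
     (\<lambda>y. (if b = v then -1 else 1) *\<^sub>R u1 (x + (y - (2 * (y \<bullet> v)) *\<^sub>R v)))"
proof (rule has_ddI)
  fix y
  let ?z = "x + (y - (2 * (y \<bullet> v)) *\<^sub>R v)" and ?s = "if b = v then -1 else 1 :: real"
  have 1: "((\<lambda>t. ?s * t) has_vector_derivative ?s) (at 0)"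
    by (auto intro!: derivative_eq_intros)
  have 2: "((\<lambda>t. u (?z + t *\<^sub>R b)) has_vector_derivative u1 ?z) (at (?s * 0))"
    using has_ddD[OF assms(4), of ?z] by simp
  have *: "x + ((y + t *\<^sub>R b) - (2 * ((y + t *\<^sub>R b) \<bullet> v)) *\<^sub>R v) = ?z + (?s * t) *\<^sub>R b" for t
    using assms(1-3) unfolding orthonormal_def by (auto simp: inner_add_left algebra_simps simp flip: scaleR_2)
  from vector_diff_chain_at[OF 1 2]
  show "((\<lambda>t. u (x + ((y + t *\<^sub>R b) - (2 * ((y + t *\<^sub>R b) \<bullet> v)) *\<^sub>R v))) has_vector_derivative ?s *\<^sub>R u1 ?z) (at 0)"
    unfolding * by (simp add: o_def)
qed

text \<open>The difference of \<open>u\<close> and its reflection in the hyperplane through \<open>x\<close> orthogonal to \<open>v\<close> is harmonic, vanishes on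
  that hyperplane and is at most \<open>2 * M\<close> on the sphere. Hence on the half-ball it lies below
  \<open>(2 * M / R\<^sup>2)\<close> times the barrier, which is evaluated on the axis. The choice \<open>N = card B + 1\<close> makes the
  barrier strictly superharmonic, as the strict form of the maximum principle demands.\<close>

lemma harmonic_symmetric_difference_upper:
  fixes u :: "'a::euclidean_space \<Rightarrow> real"
  assumes B: "orthonormal B" "v \<in> B" and u: "harmonic B u" and M: "M > 0"
    and bound: "\<And>y. y \<in> cball x R \<Longrightarrow> \<bar>u y\<bar> \<le> M"
    and s: "0 \<le> s" "s \<le> R" and R: "R > 0"
  shows "u (x + s *\<^sub>R v) - u (x - s *\<^sub>R v) \<le> 2 * real (card B + 1) * s / R * M"
proof -
  define N :: real where "N = real (card B + 1)"
  have N: "N \<ge> 1" by (simp add: N_def)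
  have fin: "finite B" using B by (simp add: orthonormal_def)
  have vv: "v \<bullet> v = 1" using B by (simp add: orthonormal_def)
  then have nv: "norm v = 1" by (simp add: norm_eq_1)
  obtain u1 u2 where u: "continuous_on UNIV u" "\<And>b. b \<in> B \<Longrightarrow> has_dd u b (u1 b)"
    "\<And>b. b \<in> B \<Longrightarrow> has_dd (u1 b) b (u2 b)" "\<And>x. (\<Sum>b\<in>B. u2 b x) = 0"
    using u unfolding harmonic_def by auto
  define \<rho> where "\<rho> = (\<lambda>y. y - (2 * (y \<bullet> v)) *\<^sub>R v)"
  have norm_\<rho>: "norm (\<rho> y) = norm y" for y
    by (simp add: \<rho>_def norm_eq_sqrt_inner inner_diff_left inner_diff_right vv inner_commute algebra_simps)
  define c where "c = 2 * M / R\<^sup>2"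
  have c: "c > 0" using M R by (simp add: c_def)
  define w where "w = (\<lambda>y. (u (y + x) - u (x + \<rho> y)) - c * barrier N R v y)"
  (* The half-ball and, up to points outside of it, its boundary. *)
  define K where "K = cball 0 R \<inter> {y. y \<bullet> v \<ge> 0}"
  define S where "S = {y. norm y = R \<or> y \<bullet> v = 0}"
  define sg where "sg = (\<lambda>b. if b = v then -1 else 1 :: real)"
  define w1 where "w1 = (\<lambda>b y. (u1 b (y + x) - sg b *\<^sub>R u1 b (x + \<rho> y)) - 
     c * (2 * (y \<bullet> b) - 2 * N * (y \<bullet> v) * (b \<bullet> v) + N * R * (b \<bullet> v)))"
  define w2 where "w2 = (\<lambda>b y. (u2 b (y + x) - sg b *\<^sub>R (sg b *\<^sub>R u2 b (x + \<rho> y))) - 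
     c * (2 * (b \<bullet> b) - 2 * N * (b \<bullet> v)\<^sup>2))"
  have "w (s *\<^sub>R v) \<le> 0"
  proof (rule strict_max_principle[where w = w and K = K and S = S and B = B and ?w1.0 = w1 and ?w2.0 = w2])
    show "compact K" unfolding K_def
      by (intro compact_Int_closed compact_cball closed_Collect_le continuous_intros)
    show "continuous_on K w" unfolding w_def \<rho>_def barrier_def
      by (intro continuous_intros continuous_on_compose2[OF u(1)]) auto
    show "has_dd w b (w1 b)" if "b \<in> B" for b
      unfolding w_def w1_def sg_def \<rho>_def
      by (rule has_dd_diff[OF has_dd_diff[OF has_dd_shift[OF u(2)[OF that]]
            has_dd_reflect[OF B that u(2)[OF that]]]
            has_dd_linear[OF bounded_linear_mult_right has_dd_barrier]])
    show "has_dd (w1 b) b (w2 b)" if "b \<in> B" for b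
      unfolding w1_def w2_def sg_def \<rho>_def
      by (rule has_dd_diff[OF has_dd_diff[OF has_dd_shift[OF u(3)[OF that]]
            has_dd_linear[OF bounded_linear_scaleR_right has_dd_reflect[OF B that u(3)[OF that]]]]
            has_dd_linear[OF bounded_linear_mult_right has_dd_barrier']])
    show "(\<Sum>b\<in>B. w2 b y) > 0" for y
    proof -
      have "w2 b y = (u2 b (y + x) - u2 b (x + \<rho> y)) - c * (2 - (if b = v then 2 * N else 0))" if "b \<in> B" for b
        using B that by (auto simp: w2_def sg_def orthonormal_def)
      then have "(\<Sum>b\<in>B. w2 b y) = (\<Sum>b\<in>B. u2 b (y + x)) - (\<Sum>b\<in>B. u2 b (x + \<rho> y)) - c * (\<Sum>b\<in>B. 2 - (if b = v then 2 * N else 0))"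
        unfolding sum_subtractf[symmetric] sum_distrib_left by (intro sum.cong) auto
      also have "(\<Sum>b\<in>B. 2 - (if b = v then 2 * N else 0)) = -2"
        using B fin by (simp add: sum_subtractf N_def)
      finally show ?thesis using u(4) c by simp
    qed
    show "s *\<^sub>R v \<in> K" using s vv nv by (simp add: K_def)
    show "\<exists>\<delta>>0. \<forall>t. \<bar>t\<bar> < \<delta> \<longrightarrow> y + t *\<^sub>R b \<in> K" if y: "y \<in> K" "y \<notin> S" and b: "b \<in> B" for y b
    proof -
      have pos: "norm y < R" "y \<bullet> v > 0" using y by (auto simp: K_def S_def)
      have bv: "\<bar>b \<bullet> v\<bar> \<le> 1" "norm b = 1" using B b by (auto simp: orthonormal_def norm_eq_1)
      show ?thesis
      proof (intro exI[of _ "min (R - norm y) (y \<bullet> v)"] conjI allI impI)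
        fix t assume t: "\<bar>t\<bar> < min (R - norm y) (y \<bullet> v)"
        have "norm (y + t *\<^sub>R b) \<le> norm y + \<bar>t\<bar>" using norm_triangle_ineq[of y "t *\<^sub>R b"] bv by simp
        moreover have "\<bar>t * (b \<bullet> v)\<bar> \<le> \<bar>t\<bar>" using bv by (simp add: abs_mult mult_left_le)
        ultimately show "y + t *\<^sub>R b \<in> K" using t by (auto simp: K_def inner_add_left)
      qed (use pos in auto)
    qed
    show "w y \<le> 0" if y: "y \<in> K" "y \<in> S" for y
    proof (cases "y \<bullet> v = 0")
      case True
      then show ?thesis using c by (simp add: w_def \<rho>_def barrier_def add.commute)
    next
      case False
      then have n: "norm y = R" "y \<bullet> v \<ge> 0" using y by (auto simp: S_def K_def)
      have "y \<bullet> v \<le> R" using norm_cauchy_schwarz[of y v] n nv by simp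
      then have "(y \<bullet> v) * (y \<bullet> v) \<le> R * (y \<bullet> v)" using n by (intro mult_right_mono) auto
      then have "N * ((y \<bullet> v) * (y \<bullet> v)) \<le> N * (R * (y \<bullet> v))" using N by (intro mult_left_mono) auto
      moreover have "y \<bullet> y = R\<^sup>2" using n by (simp add: dot_square_norm)
      ultimately have "barrier N R v y \<ge> R\<^sup>2"
        by (simp add: barrier_def power2_eq_square mult.assoc)
      then have "c * barrier N R v y \<ge> c * R\<^sup>2" using c by simp
      moreover have "c * R\<^sup>2 = 2 * M" using R by (simp add: c_def)
      moreover have "\<bar>u (y + x)\<bar> \<le> M" "\<bar>u (x + \<rho> y)\<bar> \<le> M"
        using bound[of "y + x"] bound[of "x + \<rho> y"] n norm_\<rho> by (auto simp: dist_norm)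
      ultimately show ?thesis by (simp add: w_def)
    qed
  qed
  moreover have "\<rho> (s *\<^sub>R v) = - (s *\<^sub>R v)" using scaleR_add_left[of s s v] by (simp add: \<rho>_def vv)
  ultimately have "u (x + s *\<^sub>R v) - u (x - s *\<^sub>R v) \<le> c * barrier N R v (s *\<^sub>R v)"
    by (simp add: w_def add.commute)
  also have "barrier N R v (s *\<^sub>R v) \<le> N * R * s"
  proof -
    have "s * s * 1 \<le> s * s * N" using N by (intro mult_left_mono) auto
    then show ?thesis by (simp add: barrier_def vv power2_eq_square algebra_simps)
  qed
  also have "c * (N * R * s) = 2 * N * s / R * M" using R by (simp add: c_def power2_eq_square field_simps)
  finally show ?thesis using c by (simp add: N_def)
qed


text \<open>A forward increment is a symmetric difference about the midpoint; the ball of radius \<open>r / 2\<close> about the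
  midpoint is contained in the ball of radius \<open>r\<close> about \<open>x\<close>.\<close>

lemma harmonic_increment_bound:
  fixes u :: "'a::euclidean_space \<Rightarrow> real"
  assumes B: "orthonormal B" "v \<in> B" and u: "harmonic B u" and M: "M > 0"
    and bound: "\<And>y. y \<in> cball x r \<Longrightarrow> \<bar>u y\<bar> \<le> M"
    and h: "0 < h" "h \<le> r"
  shows "\<bar>u (x + h *\<^sub>R v) - u x\<bar> \<le> 2 * real (card B + 1) * h / r * M"
proof -
  have nv: "norm v = 1" using B by (simp add: norm_eq_1 orthonormal_def)
  let ?z = "x + (h/2) *\<^sub>R v"
  have z: "?z + (h/2) *\<^sub>R v = x + h *\<^sub>R v" "?z - (h/2) *\<^sub>R v = x"
    by (simp_all add: algebra_simps flip: scaleR_add_left)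
  have *: "y \<in> cball x r" if "y \<in> cball ?z (r/2)" for y
  proof -
    have "dist x ?z = h / 2" using h nv by (simp add: dist_norm)
    then show ?thesis using dist_triangle[of x y ?z] that h by simp
  qed
  have "u (?z + (h/2) *\<^sub>R v) - u (?z - (h/2) *\<^sub>R v) \<le> 2 * real (card B + 1) * (h/2) / (r/2) * M"
    by (rule harmonic_symmetric_difference_upper[OF B u M]) (use bound * h in auto)
  moreover have "- u (?z + (h/2) *\<^sub>R v) - - u (?z - (h/2) *\<^sub>R v) \<le> 2 * real (card B + 1) * (h/2) / (r/2) * M"
    by (rule harmonic_symmetric_difference_upper[OF B harmonic_uminus[OF u] M]) (use bound * h in auto)
  ultimately show ?thesis unfolding z by (simp add: abs_le_iff)
qed

definition incr :: "'a::real_vector \<Rightarrow> ('a \<Rightarrow> real) \<Rightarrow> 'a \<Rightarrow> real" where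
  "incr w u x = u (x + w) - u x"

lemma harmonic_incr: "harmonic B u \<Longrightarrow> harmonic B (incr w u)"
  unfolding incr_def[abs_def] by (intro harmonic_diff harmonic_shift)

text \<open>Increments of harmonic functions are harmonic, so each increment costs a factor and \<open>r\<close> of the radius.\<close>

lemma harmonic_iterated_increment_bound:
  fixes u :: "'a::euclidean_space \<Rightarrow> real"
  assumes B: "orthonormal B" "v \<in> B" and h: "0 < h" "h \<le> r"
  shows "\<lbrakk>harmonic B u; M > 0; \<And>y. y \<in> cball x (j * r) \<Longrightarrow> \<bar>u y\<bar> \<le> M\<rbrakk>
     \<Longrightarrow> \<bar>(incr (h *\<^sub>R v) ^^ j) u x\<bar> \<le> (2 * real (card B + 1) * h / r) ^ j * M"
proof (induction j arbitrary: u M)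
  case 0
  then show ?case using h by simp
next
  case (Suc j)
  let ?\<theta> = "2 * real (card B + 1) * h / r"
  have \<theta>: "?\<theta> > 0" using h by simp
  have "\<bar>(incr (h *\<^sub>R v) ^^ j) (incr (h *\<^sub>R v) u) x\<bar> \<le> ?\<theta> ^ j * (?\<theta> * M)"
  proof (rule Suc.IH)
    show "harmonic B (incr (h *\<^sub>R v) u)" by (rule harmonic_incr) (rule Suc.prems)
    show "?\<theta> * M > 0" using \<theta> Suc.prems(2) by (rule mult_pos_pos)
    fix y assume y: "y \<in> cball x (j * r)"
    show "\<bar>incr (h *\<^sub>R v) u y\<bar> \<le> ?\<theta> * M"
      unfolding incr_def
    proof (rule harmonic_increment_bound[OF B Suc.prems(1,2) _ h])
      fix z assume "z \<in> cball y r"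
      then show "\<bar>u z\<bar> \<le> M" using y dist_triangle[of x z y]
        by (intro Suc.prems(3)) (auto simp: algebra_simps)
    qed
  qed
  then show ?case by (simp add: funpow_swap1 mult_ac)
qed

text \<open>The increment of order \<open>j\<close> at \<open>x\<close> involves only the values at \<open>x, x + h v, \<dots>, x + j h v\<close>.\<close>

lemma iterated_increment_eq_0:
  assumes "v \<bullet> v = 1" "h \<ge> 0"
  shows "\<lbrakk>\<And>y. y \<bullet> v \<le> c \<Longrightarrow> u y = 0; x \<bullet> v + j * h \<le> c\<rbrakk> \<Longrightarrow> (incr (h *\<^sub>R v) ^^ j) u x = 0"
proof (induction j arbitrary: u c)
  case (Suc j)
  have "(incr (h *\<^sub>R v) ^^ j) (incr (h *\<^sub>R v) u) x = 0"
    by (rule Suc.IH[where c = "c - h"])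
      (use Suc.prems assms in \<open>auto simp: incr_def inner_add_left algebra_simps\<close>)
  then show ?case by (simp add: funpow_swap1)
qed auto

text \<open>Newton's forward difference formula: the shift by \<open>w\<close> is the identity plus \<open>incr w\<close>.\<close>

lemma newton_forward: "u (x + real m *\<^sub>R w) = (\<Sum>j\<le>m. (m choose j) * (incr w ^^ j) u x)"
proof (induction m arbitrary: u)
  case (Suc m)
  have "u (x + real (Suc m) *\<^sub>R w) = u (x + real m *\<^sub>R w) + incr w u (x + real m *\<^sub>R w)"
    by (simp add: incr_def algebra_simps)
  also have "\<dots> = (\<Sum>j\<le>m. (m choose j) * (incr w ^^ j) u x) + (\<Sum>j\<le>m. (m choose j) * (incr w ^^ (Suc j)) u x)"
    by (simp add: Suc.IH funpow_swap1)
  also have "\<dots> = (\<Sum>j\<le>Suc m. (Suc m choose j) * (incr w ^^ j) u x)"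
  proof -
    have "(\<Sum>j\<le>m. (m choose j) * (incr w ^^ j) u x) = (\<Sum>j\<le>Suc m. (m choose j) * (incr w ^^ j) u x)"
      by simp
    also have "\<dots> = u x + (\<Sum>j\<le>m. (m choose Suc j) * (incr w ^^ (Suc j)) u x)"
      by (subst sum.atMost_Suc_shift) simp
    finally show ?thesis
      by (subst sum.atMost_Suc_shift[of _ m]) (simp add: algebra_simps sum.distrib)
  qed
  finally show ?case .
qed auto

text \<open>Let \<open>t = x \<bullet> v > 0\<close> and expand \<open>u x\<close> by Newton's formula from the point \<open>x - 2 t v\<close> with \<open>2 k\<close> steps of
  length \<open>t / k\<close>. The increments of order at most \<open>k\<close> only see the half-space and vanish. The
  others are at most \<open>(1/8) ^ k * M\<close> if the radius \<open>R\<close> is large enough, while the binomial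
  coefficients add up to \<open>4 ^ k\<close>. Thus \<open>\<bar>u x\<bar> \<le> (1/2) ^ k * M\<close> with \<open>M\<close> independent of \<open>k\<close>.\<close>

lemma harmonic_unique_continuation:
  fixes u :: "'a::euclidean_space \<Rightarrow> real"
  assumes B: "orthonormal B" "v \<in> B" and u: "harmonic B u"
    and zero: "\<And>x. x \<bullet> v \<le> 0 \<Longrightarrow> u x = 0"
  shows "u x = 0"
proof (cases "x \<bullet> v \<le> 0")
  case False
  define t where "t = x \<bullet> v"
  have t: "t > 0" using False by (simp add: t_def)
  have vv: "v \<bullet> v = 1" using B by (simp add: orthonormal_def)
  define N :: real where "N = real (card B + 1)"
  have N: "N \<ge> 1" by (simp add: N_def)
  (* With step t / k and 2 k balls of radius R / (2 k), each increment then contributes the factor 1 / 8. *)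
  define R where "R = 32 * N * t"
  have R: "R > 0" using N t by (simp add: R_def)
  define x0 where "x0 = x - (2 * t) *\<^sub>R v"
  have x0: "x0 \<bullet> v = - t" by (simp add: x0_def inner_diff_left vv t_def)
  have "compact (u ` cball x0 R)"
    using u by (intro compact_continuous_image) (auto simp: harmonic_def intro: continuous_on_subset)
  then obtain M where M: "M > 0" "\<And>y. y \<in> cball x0 R \<Longrightarrow> \<bar>u y\<bar> \<le> M"
    by (metis bounded_pos compact_imp_bounded image_eqI real_norm_def)
  have bound: "\<bar>u x\<bar> \<le> (1/2) ^ k * M" if k: "k > 0" for k :: nat
  proof -
    define h where "h = t / k"
    define r where "r = R / (2 * k)"
    have h: "0 < h" "h \<le> r" 
      using t k N by (auto simp: h_def r_def R_def divide_simps)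
    have \<theta>: "2 * real (card B + 1) * h / r = 1 / 8"
      unfolding N_def[symmetric] using t k N by (simp add: h_def r_def R_def divide_simps)
    have increments: "\<bar>(incr (h *\<^sub>R v) ^^ j) u x0\<bar> \<le> (1/8) ^ k * M" if j: "j \<le> 2 * k" for j
    proof (cases "j \<le> k")
      case True
      then have "t * j \<le> t * k" using t by (intro mult_left_mono) auto
      then have "x0 \<bullet> v + j * h \<le> 0"
        using k by (simp add: x0 h_def field_simps)
      then have "(incr (h *\<^sub>R v) ^^ j) u x0 = 0"
        using h by (intro iterated_increment_eq_0[OF vv _ zero]) auto
      then show ?thesis using M by simp
    next
      case False
      have "j * r \<le> (2 * k) * r" using j h by (intro mult_right_mono) auto
      also have "\<dots> = R" using k by (simp add: r_def)
      finally have "\<bar>(incr (h *\<^sub>R v) ^^ j) u x0\<bar> \<le> (2 * real (card B + 1) * h / r) ^ j * M"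
        by (intro harmonic_iterated_increment_bound[OF B h u M(1)] M(2)) auto
      also have "\<dots> \<le> (1/8) ^ k * M" unfolding \<theta> using False M
        by (intro mult_right_mono power_decreasing) auto
      finally show ?thesis .
    qed
    have "x0 + real (2 * k) *\<^sub>R (h *\<^sub>R v) = x" using k by (simp add: x0_def h_def)
    then have "u x = (\<Sum>j\<le>2*k. (2*k choose j) * (incr (h *\<^sub>R v) ^^ j) u x0)"
      using newton_forward[of u x0 "2 * k" "h *\<^sub>R v"] by simp
    also have "\<bar>\<dots>\<bar> \<le> (\<Sum>j\<le>2*k. (2*k choose j) * ((1/8) ^ k * M))"
      by (intro sum_abs[THEN order_trans] sum_mono) (auto simp: abs_mult intro!: mult_left_mono increments)
    also have "\<dots> = (\<Sum>j\<le>2*k. (2*k choose j)) * ((1/8) ^ k * M)" 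
      by (simp add: sum_distrib_right)
    also have "(\<Sum>j\<le>2*k. (2*k choose j)) = 4 ^ k" by (simp add: choose_row_sum power_mult)
    also have "real (4 ^ k) * ((1/8) ^ k * M) = (1/2) ^ k * M"
      by (simp flip: power_mult_distrib mult.assoc)
    finally show ?thesis .
  qed
  have "(\<lambda>k. (1/2) ^ k * M) \<longlonglongrightarrow> 0 * M"
    by (intro tendsto_intros LIMSEQ_power_zero) auto
  then have "\<bar>u x\<bar> \<le> 0 * M"
    by (rule LIMSEQ_le_const) (use bound in \<open>auto intro!: exI[of _ 1]\<close>)
  then show ?thesis by simp
qed (use zero in auto)

section \<open>Box averages\<close>

text \<open>The average is taken backwards, so that a function vanishing for \<open>x \<bullet> v \<le> 0\<close> keeps this property
  when it is averaged in a direction \<open>b\<close> with \<open>b \<bullet> v \<ge> 0\<close>. The integral is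
  not divided by \<open>\<epsilon>\<close>, which makes its derivative along \<open>b\<close> exactly a backward difference.\<close>

definition line_avg :: "'a::real_normed_vector \<Rightarrow> real \<Rightarrow> ('a \<Rightarrow> 'b::euclidean_space) \<Rightarrow> 'a \<Rightarrow> 'b" where
  "line_avg b \<epsilon> f x = integral {0..\<epsilon>} (\<lambda>s. f (x - s *\<^sub>R b))"

lemma line_avg_integrable:
  fixes f :: "'a::real_normed_vector \<Rightarrow> 'b::euclidean_space"
  assumes "continuous_on UNIV f"
  shows "(\<lambda>s. f (x - s *\<^sub>R b)) integrable_on {0..\<epsilon>::real}"
  by (intro integrable_continuous_real continuous_on_compose2[OF assms] continuous_intros) auto

lemma continuous_line_avg:
  assumes "continuous_on UNIV f" shows "continuous_on UNIV (line_avg b \<epsilon> f)"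
  unfolding line_avg_def[abs_def] interval_cbox
  by (rule integral_continuous_on_param)
    (auto simp: split_beta intro!: continuous_intros continuous_on_compose2[OF assms])

lemma has_dd_line_avg:
  assumes f: "continuous_on UNIV f" and f': "continuous_on UNIV f'" and d: "has_dd f c f'"
  shows "has_dd (line_avg b \<epsilon> f) c (line_avg b \<epsilon> f')"
proof (rule has_ddI)
  fix x
  have "((\<lambda>t. integral (cbox 0 \<epsilon>) (\<lambda>s. f ((x - s *\<^sub>R b) + t *\<^sub>R c))) has_vector_derivative 
      integral (cbox 0 \<epsilon>) (\<lambda>s. f' ((x - s *\<^sub>R b) + 0 *\<^sub>R c))) (at 0 within UNIV)"
  proof (rule leibniz_rule_vector_derivative)
    fix t s :: real
    show "((\<lambda>t. f (x - s *\<^sub>R b + t *\<^sub>R c)) has_vector_derivative f' (x - s *\<^sub>R b + t *\<^sub>R c)) (at t within UNIV)"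
      using has_dd_at[OF d] by simp
    show "(\<lambda>s. f (x - s *\<^sub>R b + t *\<^sub>R c)) integrable_on cbox 0 \<epsilon>"
      using line_avg_integrable[OF f, of "x + t *\<^sub>R c" b \<epsilon>] by (simp add: algebra_simps)
    show "continuous_on (UNIV \<times> cbox 0 \<epsilon>) (\<lambda>(t, s). f' (x - s *\<^sub>R b + t *\<^sub>R c))"
      by (auto simp: split_beta intro!: continuous_intros continuous_on_compose2[OF f'])
  qed auto
  then show "((\<lambda>t. line_avg b \<epsilon> f (x + t *\<^sub>R c)) has_vector_derivative line_avg b \<epsilon> f' x) (at 0)"
    by (simp add: line_avg_def algebra_simps)
qed

text \<open>The average of a merely continuous function is differentiable in the direction of averaging, since
  it is the integral of \<open>f\<close> over a segment of fixed length that moves with \<open>x\<close>.\<close>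

lemma has_dd_line_avg_same:
  assumes f: "continuous_on UNIV f" and \<epsilon>: "\<epsilon> > 0"
  shows "has_dd (line_avg b \<epsilon> f) b (\<lambda>x. f x - f (x - \<epsilon> *\<^sub>R b))"
proof (rule has_ddI)
  fix x
  define \<phi> where "\<phi> = (\<lambda>t. f (x + t *\<^sub>R b))"
  have \<phi>: "continuous_on S \<phi>" for S unfolding \<phi>_def
    by (intro continuous_on_compose2[OF f] continuous_intros) auto
  (* A lower limit to the left of all points that occur, so that Phi is differentiable there. *)
  define a where "a = - \<epsilon> - 2"
  define \<Phi> where "\<Phi> = (\<lambda>u. integral {a..u} \<phi>)"
  have \<Phi>: "(\<Phi> has_vector_derivative \<phi> u) (at u)" if "\<bar>u\<bar> < \<epsilon> + 1" for u
  proof -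
    have "(\<Phi> has_vector_derivative \<phi> u) (at u within {a..\<epsilon>+2})"
      unfolding \<Phi>_def using that by (intro integral_has_vector_derivative[OF \<phi>]) (auto simp: a_def)
    moreover have "u \<in> interior {a..\<epsilon>+2}" using that by (auto simp: a_def)
    ultimately show ?thesis by (metis at_within_interior)
  qed
  have avg: "line_avg b \<epsilon> f (x + t *\<^sub>R b) = \<Phi> t - \<Phi> (t - \<epsilon>)" if t: "\<bar>t\<bar> < 1" for t
  proof -
    have "((\<lambda>s. - \<Phi> (t - s)) has_vector_derivative \<phi> (t - s)) (at s within {0..\<epsilon>})" if "s \<in> {0..\<epsilon>}" for s
    proof -
      have 1: "((\<lambda>s. t - s) has_vector_derivative (-1)) (at s)" by (auto intro!: derivative_eq_intros)
      have "(\<Phi> \<circ> (\<lambda>s. t - s) has_vector_derivative (-1) *\<^sub>R \<phi> (t - s)) (at s)"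
        using t that by (intro vector_diff_chain_at[OF 1] \<Phi>) auto
      from has_vector_derivative_minus[OF this] show ?thesis
        by (auto simp: o_def intro: has_vector_derivative_at_within)
    qed
    then have "((\<lambda>s. \<phi> (t - s)) has_integral (- \<Phi> (t - \<epsilon>) - (- \<Phi> (t - 0)))) {0..\<epsilon>}"
      using \<epsilon> by (intro fundamental_theorem_of_calculus) auto
    from integral_unique[OF this] show ?thesis
      by (simp add: line_avg_def \<phi>_def algebra_simps)
  qed
  have shift: "((\<lambda>t. t - \<epsilon>) has_vector_derivative 1) (at 0)" by (auto intro!: derivative_eq_intros)
  have "(\<Phi> \<circ> (\<lambda>t. t - \<epsilon>) has_vector_derivative 1 *\<^sub>R \<phi> (0 - \<epsilon>)) (at 0)"
    using \<epsilon> by (intro vector_diff_chain_at[OF shift] \<Phi>) auto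
  then have "((\<lambda>t. \<Phi> t - \<Phi> (t - \<epsilon>)) has_vector_derivative (\<phi> 0 - \<phi> (- \<epsilon>))) (at 0)"
    using \<epsilon> by (intro has_vector_derivative_diff \<Phi>) (auto simp: o_def)
  then have "((\<lambda>t. line_avg b \<epsilon> f (x + t *\<^sub>R b)) has_vector_derivative (\<phi> 0 - \<phi> (- \<epsilon>))) (at 0)"
    by (rule has_vector_derivative_transform_within_open[where S = "ball 0 1"]) (auto simp: avg)
  then show "((\<lambda>t. line_avg b \<epsilon> f (x + t *\<^sub>R b)) has_vector_derivative (f x - f (x - \<epsilon> *\<^sub>R b))) (at 0)"
    by (simp add: \<phi>_def)
qed

text \<open>Averages, backward differences and their compositions have this property. It replaces the symmetry of second
  derivatives, which is not available for functions that are only known to be of class \<open>C\<^sup>1\<close>.\<close>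

definition dd_commuting :: "(('a::real_normed_vector \<Rightarrow> 'b::euclidean_space) \<Rightarrow> 'a \<Rightarrow> 'b) \<Rightarrow> bool" where
  "dd_commuting T \<longleftrightarrow> (\<forall>f. continuous_on UNIV f \<longrightarrow> continuous_on UNIV (T f)) \<and>
    (\<forall>f f' c. continuous_on UNIV f \<and> continuous_on UNIV f' \<and> has_dd f c f' \<longrightarrow> has_dd (T f) c (T f'))"

lemma dd_commuting_line_avg: "dd_commuting (line_avg b \<epsilon>)"
  unfolding dd_commuting_def using continuous_line_avg has_dd_line_avg by blast

lemma dd_commuting_backward_difference: "dd_commuting (\<lambda>f x. f x - f (x - w))"
  unfolding dd_commuting_def
proof (intro conjI allI impI)
  fix f :: "'a \<Rightarrow> 'b" assume f: "continuous_on UNIV f"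
  show "continuous_on UNIV (\<lambda>x. f x - f (x - w))"
    by (intro continuous_intros f continuous_on_compose2[OF f]) auto
next
  fix f f' :: "'a \<Rightarrow> 'b" and c
  assume "continuous_on UNIV f \<and> continuous_on UNIV f' \<and> has_dd f c f'"
  then show "has_dd (\<lambda>x. f x - f (x - w)) c (\<lambda>x. f' x - f' (x - w))"
    using has_dd_diff[OF _ has_dd_shift[where w = "- w"]] by auto
qed

lemma dd_commuting_comp: "dd_commuting S \<Longrightarrow> dd_commuting T \<Longrightarrow> dd_commuting (\<lambda>f. S (T f))"
  unfolding dd_commuting_def by meson

primrec box_avg :: "('a::real_normed_vector \<times> real) list \<Rightarrow> ('a \<Rightarrow> 'b::euclidean_space) \<Rightarrow> 'a \<Rightarrow> 'b" where
  "box_avg [] f = f"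
| "box_avg (p # l) f = line_avg (fst p) (snd p) (box_avg l f)"

lemma dd_commuting_box_avg: "dd_commuting (box_avg l)"
proof (induction l)
  case Nil
  show ?case by (simp add: dd_commuting_def)
next
  case (Cons p l)
  show ?case using dd_commuting_comp[OF dd_commuting_line_avg Cons] by simp
qed

lemma continuous_box_avg: "continuous_on UNIV f \<Longrightarrow> continuous_on UNIV (box_avg l f)"
  using dd_commuting_box_avg unfolding dd_commuting_def by blast

text \<open>The averaging in direction \<open>c\<close> turns into a backward difference, and it may be differentiated at its place in the
  composition because the averages around it commute with derivatives. The derivative is thus
  obtained from \<open>g\<close> by an operator \<open>T\<close> that commutes with derivatives in turn.\<close>

lemma box_avg_gains_derivative:
  assumes "c \<in> fst ` set l" "\<forall>p\<in>set l. snd p > 0"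
  shows "\<exists>T. dd_commuting T \<and> (\<forall>g::'a::real_normed_vector \<Rightarrow> 'b::euclidean_space. continuous_on UNIV g \<longrightarrow> has_dd (box_avg l g) c (T g))"
  using assms
proof (induction l)
  case (Cons p l)
  have cont: "continuous_on UNIV (box_avg l g)" if "continuous_on UNIV g" for g :: "'a \<Rightarrow> 'b"
    using that by (rule continuous_box_avg)
  show ?case
  proof (cases "c = fst p")
    case True
    show ?thesis
    proof (intro exI[of _ "\<lambda>g x. box_avg l g x - box_avg l g (x - snd p *\<^sub>R c)"] conjI allI impI)
      show "dd_commuting (\<lambda>(g::'a \<Rightarrow> 'b) x. box_avg l g x - box_avg l g (x - snd p *\<^sub>R c))"
        by (rule dd_commuting_comp[OF dd_commuting_backward_difference dd_commuting_box_avg])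
    qed (use True Cons.prems cont in \<open>auto intro!: has_dd_line_avg_same\<close>)
  next
    case False
    then obtain T where T: "dd_commuting T" "\<And>g::'a \<Rightarrow> 'b. continuous_on UNIV g \<Longrightarrow> has_dd (box_avg l g) c (T g)"
      using Cons by auto
    show ?thesis
    proof (intro exI[of _ "\<lambda>g. line_avg (fst p) (snd p) (T g)"] conjI allI impI)
      show "dd_commuting (\<lambda>g. line_avg (fst p) (snd p) (T g))"
        by (rule dd_commuting_comp[OF dd_commuting_line_avg T(1)])
      fix g :: "'a \<Rightarrow> 'b" assume g: "continuous_on UNIV g"
      moreover have "continuous_on UNIV (T g)" using T(1) g unfolding dd_commuting_def by blast
      ultimately show "has_dd (box_avg (p # l) g) c (line_avg (fst p) (snd p) (T g))"
        using T(2) cont by (auto intro!: has_dd_line_avg)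
    qed
  qed
qed auto

lemma line_avg_linear_combination:
  assumes L: "\<And>i. i \<in> I \<Longrightarrow> bounded_linear (L i)"
    and F: "\<And>i. i \<in> I \<Longrightarrow> continuous_on UNIV (F i)" and I: "finite I"
  shows "line_avg b \<epsilon> (\<lambda>x. \<Sum>i\<in>I. L i (F i x)) x = (\<Sum>i\<in>I. L i (line_avg b \<epsilon> (F i) x))"
proof -
  have 1: "((\<lambda>s. L i (F i (x - s *\<^sub>R b))) has_integral L i (line_avg b \<epsilon> (F i) x)) {0..\<epsilon>}" if "i \<in> I" for i
    unfolding line_avg_def
    using has_integral_linear[OF integrable_integral[OF line_avg_integrable[OF F[OF that]]] L[OF that]]
    by (simp add: o_def)
  show ?thesis unfolding line_avg_def[of b \<epsilon> "\<lambda>x. \<Sum>i\<in>I. L i (F i x)"]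
    by (intro integral_unique has_integral_sum I 1)
qed

lemma box_avg_linear_combination:
  assumes "\<And>i. i \<in> I \<Longrightarrow> bounded_linear (L i)" "\<And>i. i \<in> I \<Longrightarrow> continuous_on UNIV (F i)" "finite I"
  shows "box_avg l (\<lambda>x. \<Sum>i\<in>I. L i (F i x)) x = (\<Sum>i\<in>I. L i (box_avg l (F i) x))"
proof (induction l arbitrary: x)
  case (Cons p l)
  have "continuous_on UNIV (box_avg l (F i))" if "i \<in> I" for i
    by (intro continuous_box_avg assms that)
  then have "line_avg (fst p) (snd p) (\<lambda>x. \<Sum>i\<in>I. L i (box_avg l (F i) x)) x =
      (\<Sum>i\<in>I. L i (line_avg (fst p) (snd p) (box_avg l (F i)) x))"
    using assms by (intro line_avg_linear_combination) auto
  moreover have "box_avg l (\<lambda>x. \<Sum>i\<in>I. L i (F i x)) = (\<lambda>x. \<Sum>i\<in>I. L i (box_avg l (F i) x))"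
    by (intro ext Cons.IH)
  ultimately show ?case by simp
qed auto

lemma box_avg_zero_on_halfspace:
  assumes "\<And>x. x \<bullet> v \<le> 0 \<Longrightarrow> f x = 0" "\<And>p. p \<in> set l \<Longrightarrow> fst p \<bullet> v \<ge> 0"
  shows "x \<bullet> v \<le> 0 \<Longrightarrow> box_avg l f x = 0"
  using assms(2)
proof (induction l arbitrary: x)
  case (Cons p l)
  have "integral {0..snd p} (\<lambda>s. box_avg l f (x - s *\<^sub>R fst p)) = integral {0..snd p} (\<lambda>s. 0)"
  proof (intro integral_cong Cons.IH)
    fix s assume "s \<in> {0..snd p}"
    then have "s * (fst p \<bullet> v) \<ge> 0" using Cons.prems(2)[of p] by (intro mult_nonneg_nonneg) auto
    then show "(x - s *\<^sub>R fst p) \<bullet> v \<le> 0" using Cons.prems(1) by (simp add: inner_diff_left)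
  qed (use Cons.prems in auto)
  then show ?case by (simp add: line_avg_def)
qed (use assms in auto)

text \<open>The value \<open>f x\<close> is the derivative at \<open>\<epsilon> = 0\<close> of the averages as a function of the length \<open>\<epsilon>\<close>.\<close>

lemma zero_if_line_avgs_zero:
  assumes f: "continuous_on UNIV f" and zero: "\<And>\<epsilon>. \<epsilon> > 0 \<Longrightarrow> line_avg b \<epsilon> f x = 0"
  shows "f x = 0"
proof -
  define \<phi> where "\<phi> = (\<lambda>s. f (x - s *\<^sub>R b))"
  have \<phi>: "continuous_on {0..1} \<phi>" unfolding \<phi>_def
    by (intro continuous_on_compose2[OF f] continuous_intros) auto
  have "((\<lambda>u. integral {0..u} \<phi>) has_vector_derivative \<phi> 0) (at 0 within {0..1})"
    by (rule integral_has_vector_derivative[OF \<phi>]) auto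
  moreover have "((\<lambda>u::real. 0) has_vector_derivative 0) (at 0 within {0..1})" by simp
  moreover have "integral {0..u} \<phi> = 0" if "u \<in> {0..1}" for u
    using that zero[of u] by (cases "u = 0") (auto simp: line_avg_def \<phi>_def)
  ultimately have "\<phi> 0 = 0"
    by (intro vector_derivative_unique_within[of 0 "{0..1}" "\<lambda>u. integral {0..u} \<phi>"])
      (auto simp: trivial_limit_within intro: has_vector_derivative_transform)
  then show ?thesis by (simp add: \<phi>_def)
qed

text \<open>All side lengths are varied independently, so the averages can be removed one at a time.\<close>

lemma zero_if_box_avgs_zero:
  assumes f: "continuous_on UNIV f" 
    and zero: "\<And>l x. map fst l = bs \<Longrightarrow> \<forall>p\<in>set l. snd p > 0 \<Longrightarrow> box_avg l f x = 0"
  shows "f x = 0"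
  using zero
proof (induction bs arbitrary: x)
  case Nil
  from Nil[of "[]"] show ?case by simp
next
  case (Cons b bs)
  show ?case
  proof (rule Cons.IH)
    fix l x assume l: "map fst l = bs" "\<forall>p\<in>set l. snd p > (0::real)"
    have "continuous_on UNIV (box_avg l f)"
      by (rule continuous_box_avg[OF f])
    then show "box_avg l f x = 0"
    proof (rule zero_if_line_avgs_zero)
      fix \<epsilon> :: real assume "\<epsilon> > 0"
      then show "line_avg b \<epsilon> (box_avg l f) x = 0"
        using Cons.prems[of "(b, \<epsilon>) # l" x] l by auto
    qed
  qed
qed


section \<open>The Cauchy problem for Dirac operators\<close>

text \<open>Exchanging the summation indices and using the symmetry of \<open>T\<close>, twice the double sum is the sum of the
  anticommutators, of which only the diagonal ones survive. With second derivatives for \<open>T\<close> this is the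
  factorization of the Laplacian by a Dirac operator and its conjugate.\<close>

lemma clifford_sum:
  fixes T :: "'i \<Rightarrow> 'i \<Rightarrow> 'b::real_vector"
  assumes fin: "finite I"
    and clifford: "\<And>i j y. i \<in> I \<Longrightarrow> j \<in> I \<Longrightarrow> L' i (L j y) + L' j (L i y) = (if i = j then 2 else 0 :: real) *\<^sub>R y"
    and sym: "\<And>i j. i \<in> I \<Longrightarrow> j \<in> I \<Longrightarrow> T i j = T j i"
  shows "(\<Sum>i\<in>I. \<Sum>j\<in>I. L' i (L j (T i j))) = (\<Sum>i\<in>I. T i i)"
proof -
  let ?S = "\<Sum>i\<in>I. \<Sum>j\<in>I. L' i (L j (T i j))"
  have "?S = (\<Sum>i\<in>I. \<Sum>j\<in>I. L' j (L i (T i j)))"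
    by (subst sum.swap) (intro sum.cong refl, simp add: sym)
  then have "?S + ?S = (\<Sum>i\<in>I. \<Sum>j\<in>I. L' i (L j (T i j)) + L' j (L i (T i j)))"
    by (simp add: sum.distrib)
  also have "\<dots> = (\<Sum>i\<in>I. \<Sum>j\<in>I. if j = i then 2 *\<^sub>R T i i else 0)"
    by (intro sum.cong refl) (auto simp: clifford)
  also have "\<dots> = 2 *\<^sub>R (\<Sum>i\<in>I. T i i)"
    using fin by (simp add: scaleR_sum_right)
  finally show ?thesis by (simp flip: scaleR_2)
qed

text \<open>Every box average \<open>K\<close> of \<open>f\<close> solves the same equation and has second derivatives, so the components of \<open>K\<close>
  are harmonic by \<open>clifford_sum\<close>. They vanish on the half-space and hence everywhere; as the box is
  arbitrary, \<open>f\<close> is zero.\<close>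

lemma zero_on_halfspace_if_Dirac:
  fixes f :: "'a::euclidean_space \<Rightarrow> 'b::euclidean_space" and L L' :: "'a \<Rightarrow> 'b \<Rightarrow> 'b"
  assumes B: "orthonormal B" "v \<in> B"
    and L: "\<And>b. b \<in> B \<Longrightarrow> bounded_linear (L b)" and L': "\<And>b. b \<in> B \<Longrightarrow> bounded_linear (L' b)"
    and clifford: "\<And>b c y. b \<in> B \<Longrightarrow> c \<in> B \<Longrightarrow> L' b (L c y) + L' c (L b y) = (2 * (b \<bullet> c)) *\<^sub>R y"
    and f: "continuous_on UNIV f" and F: "\<And>b. b \<in> B \<Longrightarrow> continuous_on UNIV (F b)"
    and dd: "\<And>b. b \<in> B \<Longrightarrow> has_dd f b (F b)"
    and eq: "\<And>x. (\<Sum>b\<in>B. L b (F b x)) = 0"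
    and zero: "\<And>x. x \<bullet> v \<le> 0 \<Longrightarrow> f x = 0"
  shows "f x = 0"
proof -
  have fin: "finite B" using B by (simp add: orthonormal_def)
  obtain bs where bs: "set bs = B" using finite_list[OF fin] by auto
  show ?thesis
  proof (rule zero_if_box_avgs_zero[OF f])
    fix l x assume l: "map fst l = bs" "\<forall>p\<in>set l. snd p > (0::real)"
    then have fst_l: "fst ` set l = B" using bs by (metis set_map)
    define K where "K = box_avg l f"
    define K1 where "K1 = (\<lambda>b. box_avg l (F b))"
    have K: "has_dd K b (K1 b)" if "b \<in> B" for b
      using dd_commuting_box_avg f F[OF that] dd[OF that] unfolding K_def K1_def dd_commuting_def by blast
    have cont_K: "continuous_on UNIV K" unfolding K_def by (rule continuous_box_avg[OF f])
    have "\<forall>b\<in>B. \<exists>T. dd_commuting T \<and> (\<forall>g::'a \<Rightarrow> 'b. continuous_on UNIV g \<longrightarrow> has_dd (box_avg l g) b (T g))"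
      using box_avg_gains_derivative[OF _ l(2)] fst_l by auto
    then obtain T where T: "\<And>b. b \<in> B \<Longrightarrow> dd_commuting (T b)"
      "\<And>b g. b \<in> B \<Longrightarrow> continuous_on UNIV g \<Longrightarrow> has_dd (box_avg l (g :: 'a \<Rightarrow> 'b)) b (T b g)"
      by metis
    have K2: "has_dd (K1 c) b (T b (F c))" if "b \<in> B" "c \<in> B" for b c
      unfolding K1_def using that by (intro T(2) F)
    (* Symmetry of the second derivatives of K: both sides are the derivative of T b f along c. *)
    have sym: "T b (F c) = T c (F b)" if bc: "b \<in> B" "c \<in> B" for b c
    proof -
      have "has_dd K b (T b f)" unfolding K_def using bc by (intro T(2) f)
      then have "K1 b = T b f" using K[OF bc(1)] has_dd_unique by blast
      moreover have "has_dd (T b f) c (T b (F c))"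
        using T(1)[OF bc(1)] f F[OF bc(2)] dd[OF bc(2)] unfolding dd_commuting_def by blast
      ultimately show ?thesis using K2[OF bc(2,1)] has_dd_unique by metis
    qed
    have K1_eq: "(\<Sum>b\<in>B. L b (K1 b x)) = 0" for x
    proof -
      have "(\<Sum>b\<in>B. L b (K1 b x)) = box_avg l (\<lambda>x. \<Sum>b\<in>B. L b (F b x)) x"
        unfolding K1_def using L F fin by (simp add: box_avg_linear_combination)
      also have "\<dots> = box_avg l (\<lambda>x. \<Sum>b\<in>({}::'a set). L b (F b x)) x" by (simp add: eq)
      also have "\<dots> = (\<Sum>b\<in>{}. L b (box_avg l (F b) x))" by (rule box_avg_linear_combination) auto
      finally show ?thesis by simp
    qed
    have K2_eq: "(\<Sum>c\<in>B. L c (T b (F c) x)) = 0" if b: "b \<in> B" for b x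
    proof -
      have 1: "has_dd (\<lambda>x. \<Sum>c\<in>B. L c (K1 c x)) b (\<lambda>x. \<Sum>c\<in>B. L c (T b (F c) x))"
        by (rule has_dd_sum) (rule has_dd_linear[OF L K2[OF b]])
      have 2: "has_dd (\<lambda>x. \<Sum>c\<in>B. L c (K1 c x)) b (\<lambda>x. 0)"
        unfolding K1_eq by (simp add: has_dd_def)
      show ?thesis using has_dd_unique[OF 1 2] by (rule fun_cong)
    qed
    have laplace: "(\<Sum>b\<in>B. T b (F b) x) = 0" for x
    proof -
      have "(\<Sum>b\<in>B. T b (F b) x) = (\<Sum>b\<in>B. \<Sum>c\<in>B. L' b (L c (T b (F c) x)))"
        by (rule clifford_sum[symmetric, OF fin])
          (use B in \<open>auto simp: clifford orthonormal_def intro: fun_cong[OF sym]\<close>)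
      also have "\<dots> = (\<Sum>b\<in>B. L' b (\<Sum>c\<in>B. L c (T b (F c) x)))"
        using L' by (simp add: linear_sum bounded_linear.linear)
      also have "\<dots> = 0"
        using K2_eq L' by (simp add: linear_0 bounded_linear.linear)
      finally show ?thesis .
    qed
    have harmonic: "harmonic B (\<lambda>x. K x \<bullet> w)" for w
    proof (rule harmonicI)
      show "continuous_on UNIV (\<lambda>x. K x \<bullet> w)" by (intro continuous_intros cont_K)
      show "has_dd (\<lambda>x. K x \<bullet> w) b (\<lambda>x. K1 b x \<bullet> w)" if "b \<in> B" for b
        by (rule has_dd_linear[OF bounded_linear_inner_left K[OF that]])
      show "has_dd (\<lambda>x. K1 b x \<bullet> w) b (\<lambda>x. T b (F b) x \<bullet> w)" if "b \<in> B" for b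
        by (rule has_dd_linear[OF bounded_linear_inner_left K2[OF that that]])
      show "(\<Sum>b\<in>B. T b (F b) x \<bullet> w) = 0" for x
        using laplace by (simp flip: inner_sum_left)
    qed
    have zero_K: "K x = 0" if "x \<bullet> v \<le> 0" for x
      unfolding K_def
    proof (rule box_avg_zero_on_halfspace[OF zero _ that])
      fix p assume "p \<in> set l"
      then have "fst p \<in> B" using fst_l by auto
      then show "fst p \<bullet> v \<ge> 0" using B by (auto simp: orthonormal_def)
    qed auto
    have "K x \<bullet> K x = 0"
      by (rule harmonic_unique_continuation[OF B harmonic[of "K x"]]) (simp add: zero_K)
    then show "box_avg l f x = 0" by (simp add: K_def)
  qed
qed

lemma has_dd_bound:
  fixes f :: "'a::real_normed_vector \<Rightarrow> 'b::real_normed_vector"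
  assumes dd: "has_dd f b F" and M: "\<And>s. \<bar>s\<bar> \<le> \<bar>c\<bar> \<Longrightarrow> norm (F (x + s *\<^sub>R b)) \<le> M"
  shows "norm (f (x + c *\<^sub>R b) - f x) \<le> \<bar>c\<bar> * M"
proof -
  have "norm (f (x + c *\<^sub>R b) - f (x + 0 *\<^sub>R b)) \<le> M * norm (c - 0)"
  proof (rule differentiable_bound[where S = "{-\<bar>c\<bar>..\<bar>c\<bar>}"])
    show "((\<lambda>s. f (x + s *\<^sub>R b)) has_derivative (\<lambda>h. h *\<^sub>R F (x + s *\<^sub>R b))) (at s within {-\<bar>c\<bar>..\<bar>c\<bar>})" for s
      using has_dd_at[OF dd, of x s] unfolding has_vector_derivative_def
      by (rule has_derivative_at_withinI)
    fix s assume "s \<in> {-\<bar>c\<bar>..\<bar>c\<bar>}"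
    then show "onorm (\<lambda>h. h *\<^sub>R F (x + s *\<^sub>R b)) \<le> M"
      using M[of s] by (auto simp: onorm_scaleR_left[OF bounded_linear_ident] onorm_id)
  qed auto
  then show ?thesis by (simp add: mult.commute)
qed

text \<open>Moving from \<open>x\<close> to \<open>y\<close> one coordinate at a time, the mean value inequality bounds the change of \<open>f\<close> by the local
  maximum of the partial derivatives.\<close>

lemma continuous_if_has_continuous_dds:
  fixes f :: "'a::euclidean_space \<Rightarrow> 'b::real_normed_vector"
  assumes B: "orthonormal B"
    and proj: "\<And>x. f (\<Sum>b\<in>B. (x \<bullet> b) *\<^sub>R b) = f x"
    and F: "\<And>b. b \<in> B \<Longrightarrow> continuous_on UNIV (F b)"
    and dd: "\<And>b. b \<in> B \<Longrightarrow> has_dd f b (F b)"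
  shows "continuous_on UNIV f"
proof -
  have fin: "finite B" and nB: "\<And>b. b \<in> B \<Longrightarrow> norm b = 1"
    using B by (auto simp: orthonormal_def norm_eq_1)
  define P where "P = (\<lambda>x. \<Sum>b\<in>B. (x \<bullet> b) *\<^sub>R b)"
  have "(f \<longlongrightarrow> f x) (at x)" for x
  proof -
    (* Paths with at most card B + 1 coordinate steps of length at most 1 stay in the ball of radius R. *)
    define R where "R = real (card B) + 1"
    have "\<exists>M. \<forall>b\<in>B. \<forall>y\<in>cball (P x) R. norm (F b y) \<le> M"
    proof -
      have "\<exists>M. \<forall>y\<in>cball (P x) R. norm (F b y) \<le> M" if "b \<in> B" for b
      proof -
        have "compact (F b ` cball (P x) R)"
          using F[OF that] by (intro compact_continuous_image) (auto intro: continuous_on_subset)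
        then show ?thesis by (meson bounded_iff compact_imp_bounded image_eqI)
      qed
      then obtain m where m: "\<And>b y. b \<in> B \<Longrightarrow> y \<in> cball (P x) R \<Longrightarrow> norm (F b y) \<le> m b" by metis
      have "m b \<le> (\<Sum>b\<in>B. \<bar>m b\<bar>)" if "b \<in> B" for b
        using member_le_sum[OF that, of "\<lambda>b. \<bar>m b\<bar>"] fin by fastforce
      then show ?thesis using m by (meson order_trans)
    qed
    then obtain M where M: "\<And>b y. b \<in> B \<Longrightarrow> y \<in> cball (P x) R \<Longrightarrow> norm (F b y) \<le> M" by blast
    have path: "norm (f (P x + (\<Sum>b\<in>S. c b *\<^sub>R b)) - f (P x)) \<le> (\<Sum>b\<in>S. \<bar>c b\<bar> * M)"
      if "S \<subseteq> B" and c: "\<And>b. \<bar>c b\<bar> \<le> 1" for S c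
      using finite_subset[OF that(1) fin] that(1)
    proof (induction S rule: finite_induct)
      case (insert b S)
      let ?y = "P x + (\<Sum>b\<in>S. c b *\<^sub>R b)"
      have "norm (f (?y + c b *\<^sub>R b) - f ?y) \<le> \<bar>c b\<bar> * M"
      proof (rule has_dd_bound[OF dd])
        fix s assume s: "\<bar>s\<bar> \<le> \<bar>c b\<bar>"
        have "norm ((\<Sum>b\<in>S. c b *\<^sub>R b) + s *\<^sub>R b) \<le> (\<Sum>b\<in>S. 1) + 1"
        proof (intro norm_triangle_le add_mono sum_norm_le)
          show "norm (c b *\<^sub>R b) \<le> 1" if "b \<in> S" for b 
            using that insert.prems nB[of b] c[of b] by auto
          show "norm (s *\<^sub>R b) \<le> 1" using s insert.prems nB[of b] c[of b] by auto
        qed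
        also have "\<dots> \<le> R" using card_mono[OF fin, of S] insert.prems by (simp add: R_def)
        finally show "norm (F b (?y + s *\<^sub>R b)) \<le> M"
          using insert.prems by (intro M, simp)
            (simp only: mem_cball, subst dist_commute, simp add: dist_norm algebra_simps)
      qed (use insert.prems in auto)
      then show ?case
        using insert norm_triangle_ineq[of "f (?y + c b *\<^sub>R b) - f ?y" "f ?y - f (P x)"]
        by (simp add: algebra_simps)
    qed auto
    have bound: "norm (f y - f x) \<le> (\<Sum>b\<in>B. norm (y - x) * M)" if "norm (y - x) \<le> 1" for y
    proof -
      have c: "\<bar>(y - x) \<bullet> b\<bar> \<le> norm (y - x)" if "b \<in> B" for b
        using Cauchy_Schwarz_ineq2[of "y - x" b] nB[OF that] by simp
      define c where "c = (\<lambda>b. if b \<in> B then (y - x) \<bullet> b else 0)"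
      have le1: "\<bar>c b\<bar> \<le> 1" for b using c[of b] that by (auto simp: c_def)
      have "P y = P x + (\<Sum>b\<in>B. c b *\<^sub>R b)"
        by (simp add: P_def c_def inner_diff_left scaleR_diff_left sum_subtractf)
      then have "norm (f (P y) - f (P x)) \<le> (\<Sum>b\<in>B. \<bar>c b\<bar> * M)"
        using path[of B c] le1 by simp
      also have "\<dots> \<le> (\<Sum>b\<in>B. norm (y - x) * M)"
      proof (intro sum_mono mult_right_mono)
        fix b assume b: "b \<in> B"
        show "\<bar>c b\<bar> \<le> norm (y - x)" using c[OF b] b by (simp add: c_def)
        have "norm (F b (P x)) \<le> M" by (rule M[OF b]) (auto simp: R_def)
        then show "0 \<le> M" using norm_ge_zero order_trans by blast
      qed
      finally show ?thesis using proj by (simp add: P_def)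
    qed
    have "((\<lambda>y. f y - f x) \<longlongrightarrow> 0) (at x)"
    proof (rule Lim_null_comparison)
      have "eventually (\<lambda>y. dist y x < 1) (at x)"
        unfolding eventually_at by (intro exI[of _ 1]) simp
      then show "\<forall>\<^sub>F y in at x. norm (f y - f x) \<le> (\<Sum>b\<in>B. norm (y - x) * M)"
        by eventually_elim (rule bound, simp add: dist_norm)
      show "((\<lambda>y. \<Sum>b\<in>B. norm (y - x) * M) \<longlongrightarrow> 0) (at x)"
        by (auto intro!: tendsto_eq_intros tendsto_sum[where a="\<lambda>_. 0", simplified])
    qed
    then show ?thesis by (simp add: LIM_zero_iff)
  qed
  then show ?thesis by (simp add: continuous_on_def)
qed


text \<open>The function \<open>G\<close> continued by zero to the left of the origin is differentiable there because \<open>G\<close> vanishes to first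
  order.\<close>

lemma has_vector_derivative_clamped:
  fixes G :: "real \<Rightarrow> 'b::real_normed_vector"
  assumes G: "\<And>t. (G has_vector_derivative G' t) (at t)" and G0: "G 0 = 0" "G' 0 = 0"
  shows "((\<lambda>t. G (max 0 (s + t))) has_vector_derivative G' (max 0 s)) (at 0)"
proof -
  consider "s > 0" | "s < 0" | "s = 0" by linarith
  then show ?thesis
  proof cases
    case 1
    have shift: "((\<lambda>t. s + t) has_vector_derivative 1) (at 0)" by (auto intro!: derivative_eq_intros)
    have "((\<lambda>t. G (s + t)) has_vector_derivative G' s) (at 0)"
      using vector_diff_chain_at[OF shift, of G "G' s"] G[of s] by (simp add: o_def)
    then have "((\<lambda>t. G (max 0 (s + t))) has_vector_derivative G' s) (at 0)"
      by (rule has_vector_derivative_transform_within_open[of _ _ _ "{-s<..}"]) (use 1 in auto)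
    then show ?thesis using 1 by simp
  next
    case 2
    have "((\<lambda>t::real. 0 :: 'b) has_vector_derivative 0) (at 0)" by simp
    then have "((\<lambda>t. G (max 0 (s + t))) has_vector_derivative 0) (at 0)"
      by (rule has_vector_derivative_transform_within_open[of _ _ _ "{..<-s}"]) (use 2 G0 in auto)
    then show ?thesis using 2 G0 by simp
  next
    case 3
    have "(\<lambda>t. norm (G t) / norm t) \<midarrow>0\<rightarrow> 0"
      using G[of 0] G0 by (simp add: has_vector_derivative_def has_derivative_at)
    then have "(\<lambda>t. norm (G (max 0 t)) / norm t) \<midarrow>0\<rightarrow> 0"
      by (rule Lim_null_comparison[rotated]) (auto simp: max_def G0 divide_le_0_iff intro!: always_eventually)
    then show ?thesis
      using 3 G0 by (simp add: has_vector_derivative_def has_derivative_at)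
  qed
qed

text \<open>On the hyperplane the derivatives of \<open>f\<close> in the other directions vanish with \<open>f\<close>, and by the
  equation the derivative in direction \<open>v\<close> does too, since \<open>L v\<close> is injective. Therefore \<open>f\<close> composed with the
  projection \<open>\<pi>\<close> onto the half-space \<open>x \<bullet> v \<ge> 0\<close> is still differentiable and solves the equation on
  the whole space, and it is zero on the opposite half-space.\<close>

theorem Dirac_Cauchy_uniqueness:
  fixes f :: "'a::euclidean_space \<Rightarrow> 'b::euclidean_space" and L L' :: "'a \<Rightarrow> 'b \<Rightarrow> 'b"
  assumes B: "orthonormal B" "v \<in> B"
    and L: "\<And>b. b \<in> B \<Longrightarrow> bounded_linear (L b)" and L': "\<And>b. b \<in> B \<Longrightarrow> bounded_linear (L' b)"
    and clifford: "\<And>b c y. b \<in> B \<Longrightarrow> c \<in> B \<Longrightarrow> L' b (L c y) + L' c (L b y) = (2 * (b \<bullet> c)) *\<^sub>R y"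
    and f: "continuous_on UNIV f" and F: "\<And>b. b \<in> B \<Longrightarrow> continuous_on UNIV (F b)"
    and dd: "\<And>b. b \<in> B \<Longrightarrow> has_dd f b (F b)"
    and eq: "\<And>x. (\<Sum>b\<in>B. L b (F b x)) = 0"
    and zero: "\<And>x. x \<bullet> v = 0 \<Longrightarrow> f x = 0"
    and x: "x \<bullet> v \<ge> 0"
  shows "f x = 0"
proof -
  have fin: "finite B" using B by (simp add: orthonormal_def)
  have vv: "v \<bullet> v = 1" using B by (simp add: orthonormal_def)
  have tangential: "F b x = 0" if "x \<bullet> v = 0" "b \<in> B" "b \<noteq> v" for b x
  proof -
    have "b \<bullet> v = 0" using B that by (auto simp: orthonormal_def)
    then have "f (x + t *\<^sub>R b) = 0" for t using that by (intro zero) (simp add: inner_add_left)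
    then have "((\<lambda>t. 0) has_vector_derivative F b x) (at 0)"
      using has_ddD[OF dd[OF that(2)], of x] by simp
    then show ?thesis by (rule vector_derivative_unique_at[OF _ has_vector_derivative_const])
  qed
  have F_zero: "F b x = 0" if x: "x \<bullet> v = 0" and b: "b \<in> B" for b x
  proof (cases "b = v")
    case True
    have "(\<Sum>b\<in>B. L b (F b x)) = (\<Sum>b\<in>{v}. L b (F b x))"
      using B fin x tangential L by (intro sum.mono_neutral_right) (auto simp: linear_0 bounded_linear.linear)
    then have "L v (F v x) = 0" using eq by simp
    then have "(2 * (v \<bullet> v)) *\<^sub>R F v x = 0" 
      using clifford[OF B(2) B(2), of "F v x"] L' B by (simp add: linear_0 bounded_linear.linear)
    then show ?thesis using True vv by simp
  qed (use tangential x b in auto)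
  define \<pi> where "\<pi> = (\<lambda>x. (x - (x \<bullet> v) *\<^sub>R v) + max 0 (x \<bullet> v) *\<^sub>R v)"
  have \<pi>_cont: "continuous_on UNIV \<pi>" unfolding \<pi>_def by (intro continuous_intros)
  have \<pi>_lower: "\<pi> x \<bullet> v = 0" if "x \<bullet> v \<le> 0" for x
    using that vv by (simp add: \<pi>_def inner_diff_left)
  have dd': "has_dd (\<lambda>x. f (\<pi> x)) b (\<lambda>x. F b (\<pi> x))" if b: "b \<in> B" for b
  proof (rule has_ddI)
    fix x
    show "((\<lambda>t. f (\<pi> (x + t *\<^sub>R b))) has_vector_derivative F b (\<pi> x)) (at 0)"
    proof (cases "b = v")
      case False
      then have "b \<bullet> v = 0" using B b by (auto simp: orthonormal_def)
      then have "\<pi> (x + t *\<^sub>R b) = \<pi> x + t *\<^sub>R b" for t by (simp add: \<pi>_def inner_add_left)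
      then show ?thesis using has_ddD[OF dd[OF b]] by simp
    next
      case True
      define y where "y = x - (x \<bullet> v) *\<^sub>R v"
      have y: "y \<bullet> v = 0" by (simp add: y_def inner_diff_left vv)
      have "\<pi> (x + t *\<^sub>R b) = y + max 0 (x \<bullet> v + t) *\<^sub>R v" for t
        by (simp add: True \<pi>_def y_def inner_add_left vv algebra_simps)
      moreover have "\<pi> x = y + max 0 (x \<bullet> v) *\<^sub>R v" by (simp add: \<pi>_def y_def)
      ultimately show ?thesis
        using has_vector_derivative_clamped[OF has_dd_at[OF dd[OF B(2)], of y], of "x \<bullet> v"] zero[OF y] F_zero[OF y B(2)] True
        by simp
    qed
  qed
  have "f (\<pi> x) = 0"
    by (rule zero_on_halfspace_if_Dirac[OF B L L' clifford, where F = "\<lambda>b x. F b (\<pi> x)" and f = "\<lambda>x. f (\<pi> x)"])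
      (auto intro!: continuous_on_compose2[OF f \<pi>_cont] continuous_on_compose2[OF F \<pi>_cont] dd' eq zero \<pi>_lower)
  moreover have "\<pi> x = x" using x by (simp add: \<pi>_def)
  ultimately show ?thesis by simp
qed

section \<open>Alternativity of the octonions\<close>

lemma crd_0 [simp]: "crd 0 k = 0" by (simp add: crd_def)
lemma crd_uminus [simp]: "crd (- x) k = - crd x k" by (simp add: crd_def)
lemma crd_diff: "crd (x - y) k = crd x k - crd y k" by (simp add: crd_def)

lemma crd_basis_mult: 
  assumes "i \<le> 7" "j \<le> 7" "k \<le> 7"
  shows "crd (basis_mult i j) k = (if i = 0 then if j = k then 1 else 0 else if j = 0 then if i = k then 1 else 0
    else if k = 0 then if i = j then -1 else 0 else eps i j k)"
proof -
  have "(\<Sum>l=1..7. eps i j l * crd (\<e> l) k) = (\<Sum>l=1..7. if l = k then eps i j l else 0)"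
    using assms by (intro sum.cong) (auto simp: crd_e)
  also have "\<dots> = (if k = 0 then 0 else eps i j k)" using assms by auto
  finally have "crd (\<Sum>l=1..7. eps i j l *\<^sub>R \<e> l) k = (if k = 0 then 0 else eps i j k)" 
    by (simp only: crd_sum crd_scaleR)
  then show ?thesis using assms
    unfolding basis_mult_def by (simp add: crd_add crd_e del: One_nat_def)
qed

lemma crd_oct_mult: "k \<le> 7 \<Longrightarrow> crd (x \<odot> y) k = (\<Sum>i\<le>7. \<Sum>j\<le>7. crd x i * crd y j * 
  (if i = 0 then if j = k then 1 else 0 else if j = 0 then if i = k then 1 else 0
    else if k = 0 then if i = j then -1 else 0 else eps i j k))"
  unfolding oct_mult_def crd_sum crd_scaleR 
  by (intro sum.cong refl) (simp add: crd_basis_mult)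

lemma atMost7: "{..7::nat} = {0,1,2,3,4,5,6,7}" by auto

text \<open>The multiplication table in coordinates reduces identities in the algebra to polynomial identities.\<close>

lemma crd_oct_mult_table: 
  fixes x y :: octonion
  defines "a \<equiv> crd x" and "b \<equiv> crd y"
  shows
    "crd (x \<odot> y) 0 = a 0 * b 0 - a 1 * b 1 - a 2 * b 2 - a 3 * b 3 - a 4 * b 4 - a 5 * b 5 - a 6 * b 6 - a 7 * b 7"
    "crd (x \<odot> y) 1 = a 0 * b 1 + a 1 * b 0 + a 2 * b 3 - a 3 * b 2 + a 4 * b 5 - a 5 * b 4 - a 6 * b 7 + a 7 * b 6"
    "crd (x \<odot> y) 2 = a 0 * b 2 - a 1 * b 3 + a 2 * b 0 + a 3 * b 1 + a 4 * b 6 + a 5 * b 7 - a 6 * b 4 - a 7 * b 5"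
    "crd (x \<odot> y) 3 = a 0 * b 3 + a 1 * b 2 - a 2 * b 1 + a 3 * b 0 + a 4 * b 7 - a 5 * b 6 + a 6 * b 5 - a 7 * b 4"
    "crd (x \<odot> y) 4 = a 0 * b 4 - a 1 * b 5 - a 2 * b 6 - a 3 * b 7 + a 4 * b 0 + a 5 * b 1 + a 6 * b 2 + a 7 * b 3"
    "crd (x \<odot> y) 5 = a 0 * b 5 + a 1 * b 4 - a 2 * b 7 + a 3 * b 6 - a 4 * b 1 + a 5 * b 0 - a 6 * b 3 + a 7 * b 2"
    "crd (x \<odot> y) 6 = a 0 * b 6 + a 1 * b 7 + a 2 * b 4 - a 3 * b 5 - a 4 * b 2 + a 5 * b 3 + a 6 * b 0 - a 7 * b 1"
    "crd (x \<odot> y) 7 = a 0 * b 7 - a 1 * b 6 + a 2 * b 5 + a 3 * b 4 - a 4 * b 3 - a 5 * b 2 + a 6 * b 1 + a 7 * b 0"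
  by (simp_all add: crd_oct_mult atMost7 eps_def fano_def a_def b_def del: One_nat_def)

lemma UNIV_8: "(UNIV :: 8 set) = of_nat ` {..7}"
proof -
  have "inj_on (of_nat :: nat \<Rightarrow> 8) {..7}" by (auto simp: inj_on_def of_nat_8_eq_iff)
  then have "card ((of_nat :: nat \<Rightarrow> 8) ` {..7}) = 8" by (simp add: card_image)
  then show ?thesis by (intro card_subset_eq[symmetric]) auto
qed

lemma sum_UNIV_8: "(\<Sum>i\<in>UNIV. f i) = (\<Sum>k\<le>7. f (of_nat k :: 8))"
  unfolding UNIV_8 by (subst sum.reindex) (auto simp: inj_on_def of_nat_8_eq_iff)

lemma oct_eqI: "(\<And>k. k \<le> 7 \<Longrightarrow> crd x k = crd y k) \<Longrightarrow> x = y"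
proof -
  assume *: "\<And>k. k \<le> 7 \<Longrightarrow> crd x k = crd y k"
  have "x $ i = y $ i" for i
  proof -
    obtain k where "k \<le> 7" "i = of_nat k" using UNIV_8 by blast
    then show ?thesis using * by (simp add: crd_def)
  qed
  then show ?thesis by (simp add: vec_eq_iff)
qed

lemma inner_crd: "x \<bullet> y = (\<Sum>k\<le>7. crd x k * crd y k)"
  unfolding inner_vec_def sum_UNIV_8 by (simp add: crd_def)

lemma oct_expansion: "(\<Sum>k\<le>7. crd x k *\<^sub>R \<e> k) = x"
proof (rule oct_eqI)
  fix k :: nat assume k: "k \<le> 7"
  have "crd (\<Sum>j\<le>7. crd x j *\<^sub>R \<e> j) k = (\<Sum>j\<le>7. if j = k then crd x j else 0)"
    unfolding crd_sum crd_scaleR using k by (intro sum.cong) (auto simp: crd_e)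
  then show "crd (\<Sum>j\<le>7. crd x j *\<^sub>R \<e> j) k = crd x k" using k by simp
qed

lemma inner_e: "i \<le> 7 \<Longrightarrow> j \<le> 7 \<Longrightarrow> \<e> i \<bullet> \<e> j = (if i = j then 1 else 0)"
  by (auto simp: \<e>_def inner_axis_axis of_nat_8_eq_iff)

lemma inner_e_right: "i \<le> 7 \<Longrightarrow> x \<bullet> \<e> i = crd x i"
  by (simp add: \<e>_def inner_axis crd_def)

lemma bounded_bilinear_oct_mult: "bounded_bilinear (\<odot>)"
proof -
  have "bilinear (\<odot>)"
    unfolding bilinear_def linear_iff oct_mult_def
    by (simp add: crd_add crd_scaleR algebra_simps sum.distrib scaleR_sum_right)
  then show ?thesis by (simp add: bilinear_conv_bounded_bilinear)
qed

interpretation oct: bounded_bilinear "(\<odot>)" by (rule bounded_bilinear_oct_mult)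

definition oct_conj :: "octonion \<Rightarrow> octonion" where
  "oct_conj u = (2 * crd u 0) *\<^sub>R \<e> 0 - u"

lemma crd_oct_conj: "crd (oct_conj u) 0 = crd u 0" "0 < k \<Longrightarrow> k \<le> 7 \<Longrightarrow> crd (oct_conj u) k = - crd u k"
  by (simp_all add: oct_conj_def crd_diff crd_scaleR crd_e)

lemma oct_conj_mult_self: "oct_conj u \<odot> (u \<odot> y) = (u \<bullet> u) *\<^sub>R y"
proof (rule oct_eqI)
  fix k :: nat assume "k \<le> 7"
  then have "k \<in> {0,1,2,3,4,5,6,7}" by auto
  then show "crd (oct_conj u \<odot> (u \<odot> y)) k = crd ((u \<bullet> u) *\<^sub>R y) k"
    unfolding crd_scaleR inner_crd
    by (elim insertE emptyE; hypsubst; simp only: crd_oct_mult_table; simp add: crd_oct_conj atMost7 algebra_simps del: One_nat_def)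
qed

lemma oct_conj_add: "oct_conj (u + w) = oct_conj u + oct_conj w"
  by (simp add: oct_conj_def crd_add algebra_simps)

text \<open>Polarization of \<open>oct_conj_mult_self\<close>: left multiplications by orthonormal octonions and by their conjugates satisfy the
  Clifford relations.\<close>

lemma oct_conj_mult_polar: "oct_conj u \<odot> (w \<odot> y) + oct_conj w \<odot> (u \<odot> y) = (2 * (u \<bullet> w)) *\<^sub>R y"
proof -
  have "oct_conj (u + w) \<odot> ((u + w) \<odot> y) = ((u + w) \<bullet> (u + w)) *\<^sub>R y" by (rule oct_conj_mult_self)
  then show ?thesis
    by (simp add: oct_conj_add oct.add_left oct.add_right oct_conj_mult_self algebra_simps inner_commute scaleR_2)
qed

section \<open>Slices\<close>

lemma slice_sphere_iff:
  assumes "p \<le> 6"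
  shows "\<omega> \<in> slice_sphere p \<longleftrightarrow> (\<forall>i\<le>p. crd \<omega> i = 0) \<and> \<omega> \<bullet> \<omega> = 1"
proof -
  have upper: "(\<Sum>k\<le>7. F k) = (\<Sum>k=p+1..7. F k)" if "\<And>k. k \<le> p \<Longrightarrow> F k = (0 :: 'a :: comm_monoid_add)" for F
    using assms that by (intro sum.mono_neutral_right) auto
  show ?thesis
  proof
    assume "\<omega> \<in> slice_sphere p"
    then obtain a where a: "\<omega> = (\<Sum>i=p+1..7. a i *\<^sub>R \<e> i)" "(\<Sum>i=p+1..7. (a i)\<^sup>2) = (1::real)"
      unfolding slice_sphere_def by auto
    have crd: "crd \<omega> k = (if k > p then a k else 0)" if "k \<le> 7" for k
    proof -
      have "crd \<omega> k = (\<Sum>i=p+1..7. if i = k then a i else 0)"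
        unfolding a crd_sum crd_scaleR using that by (intro sum.cong) (auto simp: crd_e)
      then show ?thesis using that by auto
    qed
    have "\<omega> \<bullet> \<omega> = (\<Sum>k=p+1..7. crd \<omega> k * crd \<omega> k)"
      unfolding inner_crd using crd assms by (intro upper) auto
    also have "\<dots> = (\<Sum>i=p+1..7. (a i)\<^sup>2)" by (intro sum.cong) (auto simp: crd power2_eq_square)
    finally show "(\<forall>i\<le>p. crd \<omega> i = 0) \<and> \<omega> \<bullet> \<omega> = 1" using a crd assms by auto
  next
    assume \<omega>: "(\<forall>i\<le>p. crd \<omega> i = 0) \<and> \<omega> \<bullet> \<omega> = 1"
    have "(\<Sum>i=p+1..7. crd \<omega> i *\<^sub>R \<e> i) = \<omega>"
      using upper[of "\<lambda>i. crd \<omega> i *\<^sub>R \<e> i"] \<omega> by (simp add: oct_expansion)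
    moreover have "(\<Sum>i=p+1..7. (crd \<omega> i)\<^sup>2) = 1"
      using upper[of "\<lambda>i. (crd \<omega> i)\<^sup>2"] \<omega> by (simp add: inner_crd power2_eq_square)
    ultimately show "\<omega> \<in> slice_sphere p" unfolding slice_sphere_def by force
  qed
qed

definition slice_frame :: "nat \<Rightarrow> octonion \<Rightarrow> octonion set" where
  "slice_frame p \<omega> = insert \<omega> (\<e> ` {..p})"

lemma e_in_paravec: "i \<le> p \<Longrightarrow> \<e> i \<in> paravec p"
  unfolding paravec_def by (intro span_base) auto

lemma paravec_add: "x \<in> paravec p \<Longrightarrow> y \<in> paravec p \<Longrightarrow> x + y \<in> paravec p"
  unfolding paravec_def by (rule span_add)

lemma paravec_step: "x \<in> paravec p \<Longrightarrow> i \<le> p \<Longrightarrow> x + t *\<^sub>R \<e> i \<in> paravec p"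
  using paravec_add[of x p "t *\<^sub>R \<e> i"] e_in_paravec[of i p] span_scale by (auto simp: paravec_def)

lemma para_part_in_paravec: "para_part p x \<in> paravec p"
  unfolding para_part_def paravec_def by (intro span_sum span_scale span_base) auto

context
  fixes p :: nat and \<omega> :: octonion
  assumes p: "p \<le> 6" and \<omega>: "\<omega> \<in> slice_sphere p"
begin

lemma sphere_crd: "i \<le> p \<Longrightarrow> crd \<omega> i = 0" and sphere_unit: "\<omega> \<bullet> \<omega> = 1"
  using \<omega> slice_sphere_iff[OF p] by auto

lemma inner_e_sphere: "i \<le> p \<Longrightarrow> \<e> i \<bullet> \<omega> = 0" "i \<le> p \<Longrightarrow> \<omega> \<bullet> \<e> i = 0"
  using p sphere_crd[of i] inner_e_right[of i \<omega>] by (auto simp: inner_commute)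

lemma inj_on_e: "inj_on \<e> {..p}"
proof (rule inj_onI)
  fix i j assume "i \<in> {..p}" "j \<in> {..p}" "\<e> i = \<e> j"
  then show "i = j" using inner_e[of i j] inner_e[of j j] p by (auto split: if_splits)
qed

lemma sphere_notin_e: "\<omega> \<notin> \<e> ` {..p}"
  using inner_e_sphere sphere_unit by auto

lemma orthonormal_slice_frame: "orthonormal (slice_frame p \<omega>)"
  unfolding orthonormal_def slice_frame_def
  using p inner_e_sphere sphere_unit sphere_notin_e inj_on_e
  by (auto simp: inner_e inj_on_def)

lemma sum_slice_frame: "(\<Sum>b\<in>slice_frame p \<omega>. G b) = (\<Sum>i\<le>p. G (\<e> i)) + G \<omega>"
  unfolding slice_frame_def using sphere_notin_e inj_on_e
  by (simp add: sum.reindex add.commute)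

lemma slice_projection: "(\<Sum>b\<in>slice_frame p \<omega>. (x \<bullet> b) *\<^sub>R b) = para_part p x + (x \<bullet> \<omega>) *\<^sub>R \<omega>"
  unfolding sum_slice_frame para_part_def using p by (simp add: inner_e_right)

lemma paravec_orthogonal:
  assumes "x \<in> paravec p"
  shows "x \<bullet> \<omega> = 0"
proof -
  have "para_part p x \<bullet> \<omega> = 0"
    by (simp add: para_part_def inner_sum_left inner_e_sphere)
  then show ?thesis by (simp add: para_part_paravec[OF p assms])
qed

lemma para_part_sphere: "para_part p (x + r *\<^sub>R \<omega>) = para_part p x"
  by (simp add: para_part_def crd_add crd_scaleR sphere_crd)

lemma slice_coordinates:
  assumes "xp \<in> paravec p"
  shows "para_part p (xp + r *\<^sub>R \<omega>) = xp" "(xp + r *\<^sub>R \<omega>) \<bullet> \<omega> = r"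
  using assms by (simp_all add: para_part_sphere para_part_paravec[OF p] inner_add_left paravec_orthogonal sphere_unit)

lemma oct_conj_sphere: "oct_conj \<omega> = - \<omega>"
  by (simp add: oct_conj_def sphere_crd)

lemma sphere_mult_twice: "\<omega> \<odot> (\<omega> \<odot> y) = - y"
  using oct_conj_mult_self[of \<omega> y] by (simp add: oct_conj_sphere sphere_unit oct.minus_left minus_equation_iff)

text \<open>Since \<open>\<omega>\<close> is imaginary and orthogonal to the conjugate of \<open>\<e> i\<close>, this is the polarized identity for that
  conjugate and \<open>\<omega>\<close>.\<close>

lemma mult_sphere_commute: "i \<le> p \<Longrightarrow> \<e> i \<odot> (\<omega> \<odot> y) = \<omega> \<odot> (oct_conj (\<e> i) \<odot> y)"
proof -
  assume i: "i \<le> p"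
  have e0: "\<e> 0 \<bullet> \<omega> = 0" by (rule inner_e_sphere) simp
  have "oct_conj (oct_conj (\<e> i)) = \<e> i" using i p by (simp add: oct_conj_def crd_diff crd_scaleR crd_e)
  moreover have "oct_conj (\<e> i) \<bullet> \<omega> = 0"
    using i inner_e_sphere e0 by (simp add: oct_conj_def inner_diff_left)
  ultimately show ?thesis
    using oct_conj_mult_polar[of "oct_conj (\<e> i)" \<omega> y] by (simp add: oct_conj_sphere oct.minus_left)
qed

lemma uminus_sphere: "- \<omega> \<in> slice_sphere p"
  unfolding slice_sphere_iff[OF p] using sphere_crd sphere_unit by simp

end

lemma slice_decomposition:
  assumes p: "p \<le> 6"
  obtains \<omega> r where "\<omega> \<in> slice_sphere p" "x = para_part p x + r *\<^sub>R \<omega>" "r \<ge> 0"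
proof (cases "x = para_part p x")
  case True
  have "\<e> 7 \<in> slice_sphere p" unfolding slice_sphere_iff[OF p] using p by (auto simp: crd_e inner_e)
  then show ?thesis using True that[of "\<e> 7" 0] by auto
next
  case False
  let ?y = "x - para_part p x"
  have "crd (para_part p x) i = crd x i" if "i \<le> p" for i
  proof -
    have "crd (para_part p x) i = (\<Sum>k\<le>p. if k = i then crd x k else 0)"
      unfolding para_part_def crd_sum crd_scaleR using p that by (intro sum.cong) (auto simp: crd_e)
    then show ?thesis using that by simp
  qed
  then have "sgn ?y \<in> slice_sphere p"
    unfolding slice_sphere_iff[OF p] using False
    by (auto simp: sgn_div_norm crd_scaleR crd_diff dot_square_norm power2_eq_square)
  moreover have "x = para_part p x + norm ?y *\<^sub>R sgn ?y"
    using False by (simp add: sgn_div_norm)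
  ultimately show ?thesis using that by force
qed

section \<open>Uniqueness of slice monogenic extensions\<close>

lemma dir_deriv_works:
  "(\<lambda>t. f (x + t *\<^sub>R v)) differentiable (at 0) \<Longrightarrow> ((\<lambda>t. f (x + t *\<^sub>R v)) has_vector_derivative dir_deriv v f x) (at 0)"
  by (simp add: dir_deriv_def vector_derivative_works)

text \<open>On the slice through \<open>x\<close>, the difference of the two functions composed with the orthogonal projection \<open>P\<close> onto the
  slice is a solution of a Cauchy problem with zero data on the whole space.\<close>

lemma slice_monogenic_eqI:
  assumes p: "p \<le> 6" and g: "slice_monogenic p UNIV g" and g': "slice_monogenic p UNIV g'"
    and init: "\<And>x. x \<in> paravec p \<Longrightarrow> g x = g' x"
  shows "g x = g' x"
proof -
  obtain \<omega> r where \<omega>: "\<omega> \<in> slice_sphere p" and x: "x = para_part p x + r *\<^sub>R \<omega>" and r: "r \<ge> 0"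
    by (rule slice_decomposition[OF p])
  let ?B = "slice_frame p \<omega>" and ?S = "slice_space p \<omega>"
  define P where "P = (\<lambda>x. \<Sum>b\<in>?B. (x \<bullet> b) *\<^sub>R b)"
  have P: "P x = para_part p x + (x \<bullet> \<omega>) *\<^sub>R \<omega>" for x
    unfolding P_def by (rule slice_projection[OF p \<omega>])
  have P_slice: "P x \<in> ?S" for x
    unfolding P slice_space_def using para_part_in_paravec by blast
  note on = orthonormal_slice_frame[OF p \<omega>]
  have P_step: "P (x + t *\<^sub>R b) = P x + t *\<^sub>R b" if "b \<in> ?B" for x b t
  proof -
    have "(\<Sum>c\<in>?B. (t * (b \<bullet> c)) *\<^sub>R c) = (\<Sum>c\<in>?B. if c = b then t *\<^sub>R b else 0)"
      using on that by (intro sum.cong) (auto simp: orthonormal_def)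
    also have "\<dots> = t *\<^sub>R b" using on that by (simp add: orthonormal_def)
    finally show ?thesis
      by (simp add: P_def inner_add_left scaleR_add_left sum.distrib)
  qed
  have P_idem: "P (\<Sum>b\<in>?B. (x \<bullet> b) *\<^sub>R b) = P x" for x
    unfolding slice_projection[OF p \<omega>] P using slice_coordinates[OF p \<omega> para_part_in_paravec] by simp
  have P_cont: "continuous_on UNIV P" unfolding P_def by (intro continuous_intros)
  have C1: "(\<lambda>t. g (y + t *\<^sub>R b)) differentiable (at 0)" "(\<lambda>t. g' (y + t *\<^sub>R b)) differentiable (at 0)" 
     if "y \<in> ?S" "b \<in> ?B" for y b
    using g g' \<omega> that unfolding slice_monogenic_def C1_on_slice_def slice_frame_def by auto
  have C1': "continuous_on ?S (dir_deriv b g)" "continuous_on ?S (dir_deriv b g')" if "b \<in> ?B" for b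
    using g g' \<omega> that unfolding slice_monogenic_def C1_on_slice_def slice_frame_def by auto
  define f where "f = (\<lambda>x. g (P x) - g' (P x))"
  define F where "F = (\<lambda>b x. dir_deriv b g (P x) - dir_deriv b g' (P x))"
  have dd: "has_dd f b (F b)" if "b \<in> ?B" for b
    unfolding has_dd_def f_def F_def P_step[OF that]
    by (intro allI has_vector_derivative_diff dir_deriv_works C1 P_slice that)
  have F: "continuous_on UNIV (F b)" if "b \<in> ?B" for b
    unfolding F_def
    by (intro continuous_intros continuous_on_compose2[OF C1'(1)[OF that] P_cont]
        continuous_on_compose2[OF C1'(2)[OF that] P_cont]) (auto simp: P_slice)
  have f: "continuous_on UNIV f"
    by (rule continuous_if_has_continuous_dds[OF on _ F dd])
      (simp_all add: f_def P_idem)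
  have eq: "(\<Sum>b\<in>?B. b \<odot> F b x) = 0" for x
  proof -
    have "(\<Sum>b\<in>?B. b \<odot> dir_deriv b h (P x)) = 0" if "slice_monogenic p UNIV h" for h
      using that \<omega> P_slice[of x] unfolding sum_slice_frame[OF p \<omega>] slice_monogenic_def by auto
    then show ?thesis using g g' by (simp add: F_def oct.diff_right sum_subtractf)
  qed
  have "f x = 0"
  proof (rule Dirac_Cauchy_uniqueness[where f = f and x = x and B = ?B and v = \<omega> and L = "(\<odot>)" and L' = "\<lambda>b. (\<odot>) (oct_conj b)" and F = F])
    show "f y = 0" if "y \<bullet> \<omega> = 0" for y
      using that init para_part_in_paravec by (simp add: f_def P)
    show "x \<bullet> \<omega> \<ge> 0"
      using slice_coordinates(2)[OF p \<omega> para_part_in_paravec, of x r] x r by simp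
  qed (auto simp: slice_frame_def on[unfolded slice_frame_def] oct.bounded_linear_right oct_conj_mult_polar 
      intro!: f dd[unfolded slice_frame_def] F[unfolded slice_frame_def] eq[unfolded slice_frame_def])
  moreover have "P x = x"
    using slice_coordinates(2)[OF p \<omega> para_part_in_paravec, of x r] x by (simp add: P)
  ultimately show ?thesis by (simp add: f_def)
qed

section \<open>Polynomials on the paravectors\<close>

lemma dir_deriv_lincomb:
  assumes "finite I" "\<And>a. a \<in> I \<Longrightarrow> bounded_linear (L a)"
    "\<And>a. a \<in> I \<Longrightarrow> (\<lambda>t. f a (x + t *\<^sub>R v)) differentiable (at 0)"
  shows "(\<lambda>t. \<Sum>a\<in>I. L a (f a (x + t *\<^sub>R v))) differentiable (at 0)"
    and "dir_deriv v (\<lambda>x. \<Sum>a\<in>I. L a (f a x)) x = (\<Sum>a\<in>I. L a (dir_deriv v (f a) x))"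
proof -
  have "((\<lambda>t. \<Sum>a\<in>I. L a (f a (x + t *\<^sub>R v))) has_vector_derivative (\<Sum>a\<in>I. L a (dir_deriv v (f a) x))) (at 0)"
    by (rule has_vector_derivative_sum)
      (rule bounded_linear.has_vector_derivative[OF assms(2) dir_deriv_works[OF assms(3)]])
  then show "(\<lambda>t. \<Sum>a\<in>I. L a (f a (x + t *\<^sub>R v))) differentiable (at 0)"
    "dir_deriv v (\<lambda>x. \<Sum>a\<in>I. L a (f a x)) x = (\<Sum>a\<in>I. L a (dir_deriv v (f a) x))"
    by (auto simp: dir_deriv_def vector_derivative_at intro: differentiableI_vector)
qed

lemma dir_deriv_cong:
  assumes "\<And>y. y \<in> paravec p \<Longrightarrow> f y = g y" "x \<in> paravec p" "i \<le> p"
  shows "dir_deriv (\<e> i) f x = dir_deriv (\<e> i) g x"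
  unfolding dir_deriv_def using assms paravec_step by simp

text \<open>Polynomials of degree below \<open>d\<close> on the paravectors, characterized by their derivatives: all partial
  derivatives up to order \<open>d\<close> exist, they commute, and those of order \<open>d\<close> vanish. In this form the closure
  under derivatives and linear combinations needs no manipulation of coefficients, and it is immediate that the
  Laplacian is nilpotent.\<close>

primrec poly_below :: "nat \<Rightarrow> nat \<Rightarrow> (octonion \<Rightarrow> octonion) \<Rightarrow> bool" where
  "poly_below p 0 f \<longleftrightarrow> (\<forall>x\<in>paravec p. f x = 0)"
| "poly_below p (Suc d) f \<longleftrightarrow> continuous_on (paravec p) f \<and>
     (\<forall>i\<le>p. (\<forall>x\<in>paravec p. (\<lambda>t. f (x + t *\<^sub>R \<e> i)) differentiable (at (0::real))) \<and>
        poly_below p d (dir_deriv (\<e> i) f)) \<and>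
     (\<forall>i\<le>p. \<forall>j\<le>p. \<forall>x\<in>paravec p.
        dir_deriv (\<e> i) (dir_deriv (\<e> j) f) x = dir_deriv (\<e> j) (dir_deriv (\<e> i) f) x)"

lemma poly_below_cong:
  assumes "\<And>x. x \<in> paravec p \<Longrightarrow> f x = g x"
  shows "poly_below p d f \<longleftrightarrow> poly_below p d g"
  using assms
proof (induction d arbitrary: f g)
  case (Suc d)
  have 1: "dir_deriv (\<e> i) f x = dir_deriv (\<e> i) g x" if "x \<in> paravec p" "i \<le> p" for x i
    using Suc.prems that by (rule dir_deriv_cong)
  have 2: "dir_deriv (\<e> j) (dir_deriv (\<e> i) f) x = dir_deriv (\<e> j) (dir_deriv (\<e> i) g) x"
    if "x \<in> paravec p" "i \<le> p" "j \<le> p" for x i j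
    by (rule dir_deriv_cong[OF 1[OF _ that(2)] that(1,3)])
  have 3: "poly_below p d (dir_deriv (\<e> i) f) \<longleftrightarrow> poly_below p d (dir_deriv (\<e> i) g)" if "i \<le> p" for i
    using 1 that by (intro Suc.IH)
  have 4: "(\<lambda>t. f (x + t *\<^sub>R \<e> i)) = (\<lambda>t. g (x + t *\<^sub>R \<e> i))" if "x \<in> paravec p" "i \<le> p" for x i
    using Suc.prems that paravec_step by simp
  have 5: "continuous_on (paravec p) f \<longleftrightarrow> continuous_on (paravec p) g"
    using Suc.prems by (intro continuous_on_cong) auto
  show ?case using 2 3 4 5 by simp
qed auto

lemma dir_deriv_zero: "dir_deriv v (\<lambda>x. 0) = (\<lambda>x. 0)"
  by (auto simp: dir_deriv_def intro!: vector_derivative_at)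

lemma poly_below_zero: "poly_below p d (\<lambda>x. 0)"
  by (induction d) (simp_all add: dir_deriv_zero)

lemma poly_below_Suc: "poly_below p d f \<Longrightarrow> poly_below p (Suc d) f"
proof (induction d arbitrary: f)
  case 0
  then show ?case using poly_below_cong[of p f "\<lambda>x. 0" "Suc 0"] poly_below_zero by simp
qed auto

lemma poly_below_mono: "d \<le> d' \<Longrightarrow> poly_below p d f \<Longrightarrow> poly_below p d' f"
  by (induction d' rule: dec_induct) (auto simp del: poly_below.simps intro: poly_below_Suc)

lemma poly_below_dir_deriv: "poly_below p d f \<Longrightarrow> i \<le> p \<Longrightarrow> poly_below p (d - 1) (dir_deriv (\<e> i) f)"
  using poly_below_Suc[of p d f] by (cases d) auto

lemma poly_below_dir_deriv': "poly_below p d f \<Longrightarrow> i \<le> p \<Longrightarrow> poly_below p d (dir_deriv (\<e> i) f)"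
  by (rule poly_below_mono[OF diff_le_self poly_below_dir_deriv])

lemma
  assumes "poly_below p d f"
  shows poly_below_continuous: "continuous_on (paravec p) f"
    and poly_below_differentiable:
      "x \<in> paravec p \<Longrightarrow> i \<le> p \<Longrightarrow> (\<lambda>t. f (x + t *\<^sub>R \<e> i)) differentiable (at (0::real))"
    and poly_below_commute: "x \<in> paravec p \<Longrightarrow> i \<le> p \<Longrightarrow> j \<le> p \<Longrightarrow>
      dir_deriv (\<e> i) (dir_deriv (\<e> j) f) x = dir_deriv (\<e> j) (dir_deriv (\<e> i) f) x"
  using poly_below_Suc[OF assms] by auto

text \<open>The coefficients are linear maps rather than numbers in order to cover left multiplications by octonions.\<close>

lemma poly_below_lincomb:
  assumes "finite I" "\<And>a. a \<in> I \<Longrightarrow> bounded_linear (L a)" "\<And>a. a \<in> I \<Longrightarrow> poly_below p d (f a)"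
  shows "poly_below p d (\<lambda>x. \<Sum>a\<in>I. L a (f a x))"
  using assms(3)
proof (induction d arbitrary: f)
  case 0
  then show ?case using assms(2) by (auto simp: linear_0 bounded_linear.linear)
next
  case (Suc d)
  let ?S = "\<lambda>f x. \<Sum>a\<in>I. L a (f a x)"
  note diff = poly_below_differentiable[OF Suc.prems]
  have D: "dir_deriv (\<e> i) (?S f) x = ?S (\<lambda>a. dir_deriv (\<e> i) (f a)) x" if "x \<in> paravec p" "i \<le> p" for x i
    using that by (intro dir_deriv_lincomb assms(1,2) diff)
  have D2: "dir_deriv (\<e> j) (dir_deriv (\<e> i) (?S f)) x = ?S (\<lambda>a. dir_deriv (\<e> j) (dir_deriv (\<e> i) (f a))) x" 
    if "x \<in> paravec p" "i \<le> p" "j \<le> p" for x i j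
  proof -
    have "dir_deriv (\<e> j) (dir_deriv (\<e> i) (?S f)) x = dir_deriv (\<e> j) (?S (\<lambda>a. dir_deriv (\<e> i) (f a))) x"
      using D that by (intro dir_deriv_cong)
    also have "\<dots> = ?S (\<lambda>a. dir_deriv (\<e> j) (dir_deriv (\<e> i) (f a))) x"
      using that Suc.prems by (intro dir_deriv_lincomb assms(1,2) poly_below_differentiable[OF poly_below_dir_deriv']) 
    finally show ?thesis .
  qed
  show ?case unfolding poly_below.simps
  proof (intro conjI allI impI ballI)
    show "continuous_on (paravec p) (?S f)"
      by (rule continuous_on_sum)
        (rule bounded_linear.continuous_on[OF assms(2) poly_below_continuous[OF Suc.prems]])
    show "(\<lambda>t. ?S f (x + t *\<^sub>R \<e> i)) differentiable (at 0)" if "i \<le> p" "x \<in> paravec p" for i x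
      using that by (intro dir_deriv_lincomb assms(1,2) diff)
    show "poly_below p d (dir_deriv (\<e> i) (?S f))" if "i \<le> p" for i
    proof -
      have "poly_below p d (?S (\<lambda>a. dir_deriv (\<e> i) (f a)))"
        using Suc.prems that by (intro Suc.IH) simp
      moreover have "poly_below p d (dir_deriv (\<e> i) (?S f)) \<longleftrightarrow> poly_below p d (?S (\<lambda>a. dir_deriv (\<e> i) (f a)))"
        by (rule poly_below_cong) (rule D[OF _ that])
      ultimately show ?thesis by simp
    qed
    show "dir_deriv (\<e> i) (dir_deriv (\<e> j) (?S f)) x = dir_deriv (\<e> j) (dir_deriv (\<e> i) (?S f)) x"
      if "i \<le> p" "j \<le> p" "x \<in> paravec p" for i j x
      using that by (simp add: D2 poly_below_commute[OF Suc.prems] cong: sum.cong)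
  qed
qed

definition monomial :: "nat \<Rightarrow> (nat \<Rightarrow> nat) \<Rightarrow> octonion \<Rightarrow> octonion \<Rightarrow> octonion" where
  "monomial p \<alpha> w x = (\<Prod>k\<le>p. crd x k ^ \<alpha> k) *\<^sub>R w"

lemma monomial_has_vector_derivative:
  assumes p: "p \<le> 6" and i: "i \<le> p"
  shows "((\<lambda>t. monomial p \<alpha> w (x + t *\<^sub>R \<e> i)) has_vector_derivative 
    real (\<alpha> i) *\<^sub>R monomial p (\<alpha>(i := \<alpha> i - 1)) w x) (at 0)"
proof -
  define C where "C = (\<Prod>k\<in>{..p} - {i}. crd x k ^ \<alpha> k)"
  have split: "(\<Prod>k\<le>p. F k) = F i * (\<Prod>k\<in>{..p} - {i}. F k)" for F :: "nat \<Rightarrow> real"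
    using i by (simp add: prod.remove)
  have "(\<Prod>k\<in>{..p} - {i}. crd (x + t *\<^sub>R \<e> i) k ^ \<alpha> k) = C" for t
    unfolding C_def using p i by (intro prod.cong) (auto simp: crd_add crd_scaleR crd_e)
  then have 1: "monomial p \<alpha> w (x + t *\<^sub>R \<e> i) = ((crd x i + t) ^ \<alpha> i * C) *\<^sub>R w" for t
    unfolding monomial_def split using p i by (simp add: crd_add crd_scaleR crd_e)
  have "(\<Prod>k\<in>{..p} - {i}. crd x k ^ (\<alpha>(i := \<alpha> i - 1)) k) = C"
    unfolding C_def by (intro prod.cong) auto
  then have 2: "monomial p (\<alpha>(i := \<alpha> i - 1)) w x = (crd x i ^ (\<alpha> i - 1) * C) *\<^sub>R w"
    unfolding monomial_def split by simp
  have "((\<lambda>t. (crd x i + t) ^ \<alpha> i * C) has_real_derivative real (\<alpha> i) * (crd x i ^ (\<alpha> i - 1) * C)) (at 0)"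
    by (auto intro!: derivative_eq_intros)
  from bounded_linear.has_vector_derivative[OF bounded_linear_scaleR_left[of w] this[unfolded has_real_derivative_iff_has_vector_derivative]]
  show ?thesis unfolding 1 2 by simp
qed

lemma dir_deriv_monomial:
  assumes "p \<le> 6" "i \<le> p"
  shows "dir_deriv (\<e> i) (monomial p \<alpha> w) = (\<lambda>x. real (\<alpha> i) *\<^sub>R monomial p (\<alpha>(i := \<alpha> i - 1)) w x)"
  unfolding dir_deriv_def by (intro ext vector_derivative_at monomial_has_vector_derivative assms)

lemma dir_deriv_scaled_monomial:
  assumes "p \<le> 6" "i \<le> p"
  shows "dir_deriv (\<e> i) (\<lambda>x. c *\<^sub>R monomial p \<alpha> w x) x = (c * real (\<alpha> i)) *\<^sub>R monomial p (\<alpha>(i := \<alpha> i - 1)) w x"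
  unfolding dir_deriv_def scaleR_scaleR[symmetric]
  by (intro vector_derivative_at bounded_linear.has_vector_derivative[OF bounded_linear_scaleR_right] monomial_has_vector_derivative assms)

lemma poly_below_monomial:
  assumes p: "p \<le> 6"
  shows "(\<Sum>k\<le>p. \<alpha> k) < d \<Longrightarrow> poly_below p d (monomial p \<alpha> w)"
proof (induction d arbitrary: \<alpha>)
  case (Suc d)
  show ?case unfolding poly_below.simps
  proof (intro conjI allI impI ballI)
    show "continuous_on (paravec p) (monomial p \<alpha> w)"
      unfolding monomial_def crd_def by (intro continuous_intros)
    show "(\<lambda>t. monomial p \<alpha> w (x + t *\<^sub>R \<e> i)) differentiable (at 0)" if "i \<le> p" for i x
      using monomial_has_vector_derivative[OF p that] by (rule differentiableI_vector)
    show "poly_below p d (dir_deriv (\<e> i) (monomial p \<alpha> w))" if i: "i \<le> p" for i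
    proof (cases "\<alpha> i = 0")
      case True
      then show ?thesis by (simp add: dir_deriv_monomial[OF p i] poly_below_zero)
    next
      case False
      have "(\<Sum>k\<le>p. (\<alpha>(i := \<alpha> i - 1)) k) < (\<Sum>k\<le>p. \<alpha> k)"
        using False i by (intro sum_strict_mono_ex1) auto
      then have "poly_below p d (monomial p (\<alpha>(i := \<alpha> i - 1)) w)"
        using Suc.prems by (intro Suc.IH) simp
      then show ?thesis unfolding dir_deriv_monomial[OF p i]
        using poly_below_lincomb[of "{()}" "\<lambda>_. (*\<^sub>R) (real (\<alpha> i))" p d "\<lambda>_. monomial p (\<alpha>(i := \<alpha> i - 1)) w"]
        by (simp add: bounded_linear_scaleR_right)
    qed
    show "dir_deriv (\<e> i) (dir_deriv (\<e> j) (monomial p \<alpha> w)) x = dir_deriv (\<e> j) (dir_deriv (\<e> i) (monomial p \<alpha> w)) x"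
      if "i \<le> p" "j \<le> p" for i j x
      using that by (cases "i = j") (simp_all add: dir_deriv_monomial[OF p] dir_deriv_scaled_monomial[OF p] fun_upd_twist mult.commute)
  qed
qed simp

lemma oct_polynomial_poly_below:
  assumes p: "p \<le> 6" and f: "oct_polynomial p f"
  obtains d where "poly_below p d f"
proof -
  define Q :: "nat \<Rightarrow> (nat \<Rightarrow> nat) set \<Rightarrow> ((nat \<Rightarrow> nat) \<Rightarrow> real) \<Rightarrow> bool" where
    "Q = (\<lambda>j A c. finite A \<and> (\<forall>x\<in>paravec p. crd (f x) j = (\<Sum>\<alpha>\<in>A. c \<alpha> * (\<Prod>i\<le>p. crd x i ^ \<alpha> i))))"
  have "\<forall>j. \<exists>q. j \<le> 7 \<longrightarrow> Q j (fst q) (snd q)"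
    using f unfolding oct_polynomial_def Q_def by auto
  from choice[OF this] obtain q where q: "\<And>j. j \<le> 7 \<Longrightarrow> Q j (fst (q j)) (snd (q j))" by auto
  define A c where "A = (\<lambda>j. fst (q j))" and "c = (\<lambda>j. snd (q j))"
  have Ac: "finite (A j)"
    "x \<in> paravec p \<Longrightarrow> crd (f x) j = (\<Sum>\<alpha>\<in>A j. c j \<alpha> * (\<Prod>i\<le>p. crd x i ^ \<alpha> i))" if "j \<le> 7" for j x
    using q[OF that] by (auto simp: Q_def A_def c_def)
  let ?I = "SIGMA j:{..7}. A j"
  have fin: "finite ?I" using Ac(1) by auto
  (* Any strict upper bound for the degrees of all monomials of all components will do. *)
  define d where "d = Suc (\<Sum>(j,\<alpha>)\<in>?I. \<Sum>i\<le>p. \<alpha> i)"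
  have "poly_below p d (\<lambda>x. \<Sum>a\<in>?I. (*\<^sub>R) (c (fst a) (snd a)) (monomial p (snd a) (\<e> (fst a)) x))"
  proof (rule poly_below_lincomb[OF fin bounded_linear_scaleR_right poly_below_monomial[OF p]])
    fix a assume "a \<in> ?I"
    then have "(case a of (j, \<alpha>) \<Rightarrow> \<Sum>i\<le>p. \<alpha> i) \<le> (\<Sum>(j,\<alpha>)\<in>?I. \<Sum>i\<le>p. \<alpha> i)"
      by (intro member_le_sum fin) auto
    then show "(\<Sum>i\<le>p. snd a i) < d" by (simp add: d_def split_beta)
  qed
  moreover have "(\<Sum>a\<in>?I. c (fst a) (snd a) *\<^sub>R monomial p (snd a) (\<e> (fst a)) x) = f x" if x: "x \<in> paravec p" for x
  proof -
    have "(\<Sum>a\<in>?I. c (fst a) (snd a) *\<^sub>R monomial p (snd a) (\<e> (fst a)) x) = 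
        (\<Sum>j\<le>7. \<Sum>\<alpha>\<in>A j. c j \<alpha> *\<^sub>R monomial p \<alpha> (\<e> j) x)"
      using Ac(1) by (subst sum.Sigma) (auto simp: split_beta)
    also have "\<dots> = (\<Sum>j\<le>7. crd (f x) j *\<^sub>R \<e> j)"
      using Ac(2) x by (intro sum.cong) (auto simp: monomial_def scaleR_sum_left)
    finally show ?thesis by (simp add: oct_expansion)
  qed
  then have "poly_below p d (\<lambda>x. \<Sum>a\<in>?I. c (fst a) (snd a) *\<^sub>R monomial p (snd a) (\<e> (fst a)) x) \<longleftrightarrow>
      poly_below p d f" by (rule poly_below_cong)
  ultimately have "poly_below p d f" by simp
  then show ?thesis using that by blast
qed


section \<open>Dirac and Laplace operators on polynomials\<close>

definition conj_Dirac :: "nat \<Rightarrow> (octonion \<Rightarrow> octonion) \<Rightarrow> octonion \<Rightarrow> octonion" where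
  "conj_Dirac p f x = (\<Sum>i\<le>p. oct_conj (\<e> i) \<odot> dir_deriv (\<e> i) f x)"

lemma poly_below_para_Dirac:
  assumes "poly_below p d f" shows "poly_below p d (para_Dirac p f)"
  unfolding para_Dirac_def[abs_def]
  by (rule poly_below_lincomb) (use assms in \<open>auto intro: oct.bounded_linear_right poly_below_dir_deriv'\<close>)

lemma neg_Laplacian_alt: "neg_Laplacian p f x = (\<Sum>i\<le>p. - dir_deriv (\<e> i) (dir_deriv (\<e> i) f) x)"
  by (simp add: neg_Laplacian_def sum_negf)

lemma poly_below_neg_Laplacian:
  assumes "poly_below p d f" shows "poly_below p (d - 1) (neg_Laplacian p f)"
  unfolding neg_Laplacian_alt[abs_def]
  by (rule poly_below_lincomb[where L = "\<lambda>_. uminus"])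
    (use assms in \<open>auto intro: poly_below_dir_deriv[OF poly_below_dir_deriv', simplified] bounded_linear_minus bounded_linear_ident\<close>)

lemma poly_below_neg_Laplacian_funpow:
  assumes "poly_below p d f" shows "poly_below p (d - k) ((neg_Laplacian p ^^ k) f)"
proof (induction k)
  case (Suc k)
  then show ?case using poly_below_neg_Laplacian[of p "d - k"] by simp
qed (use assms in simp)

lemma poly_below_neg_Laplacian_funpow':
  assumes "poly_below p d f" shows "poly_below p d ((neg_Laplacian p ^^ k) f)"
  by (rule poly_below_mono[OF diff_le_self poly_below_neg_Laplacian_funpow[OF assms]])

lemma neg_Laplacian_cong:
  assumes "\<And>y. y \<in> paravec p \<Longrightarrow> f y = g y" "x \<in> paravec p"
  shows "neg_Laplacian p f x = neg_Laplacian p g x"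
  unfolding neg_Laplacian_alt
  by (intro sum.cong refl arg_cong[where f = uminus] dir_deriv_cong[OF dir_deriv_cong[OF assms(1)]]) (use assms(2) in auto)

lemma conj_Dirac_cong:
  assumes "\<And>y. y \<in> paravec p \<Longrightarrow> f y = g y" "x \<in> paravec p"
  shows "conj_Dirac p f x = conj_Dirac p g x"
  unfolding conj_Dirac_def
  by (intro sum.cong refl arg_cong[where f = "(\<odot>) _"] dir_deriv_cong[OF assms(1)]) (use assms(2) in auto)

lemma dir_deriv_para_Dirac:
  assumes f: "poly_below p d f" and x: "x \<in> paravec p" and j: "j \<le> p"
  shows "dir_deriv (\<e> j) (para_Dirac p f) x = (\<Sum>i\<le>p. \<e> i \<odot> dir_deriv (\<e> j) (dir_deriv (\<e> i) f) x)"
  unfolding para_Dirac_def[abs_def]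
  by (rule dir_deriv_lincomb(2)[OF _ oct.bounded_linear_right])
    (use assms in \<open>auto intro: poly_below_differentiable[OF poly_below_dir_deriv']\<close>)

text \<open>The factorization of the Laplacian, by \<open>clifford_sum\<close>; the case \<open>i = 0\<close> is covered by the conjugation.\<close>

lemma conj_Dirac_para_Dirac:
  assumes p: "p \<le> 6" and f: "poly_below p d f" and x: "x \<in> paravec p"
  shows "conj_Dirac p (para_Dirac p f) x = - neg_Laplacian p f x"
proof -
  let ?D = "\<lambda>i j. dir_deriv (\<e> i) (dir_deriv (\<e> j) f) x"
  have "conj_Dirac p (para_Dirac p f) x = (\<Sum>i\<le>p. \<Sum>j\<le>p. oct_conj (\<e> i) \<odot> (\<e> j \<odot> ?D i j))"
    unfolding conj_Dirac_def by (intro sum.cong refl) (simp add: dir_deriv_para_Dirac[OF f x] oct.sum_right)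
  also have "\<dots> = (\<Sum>i\<le>p. ?D i i)"
    by (rule clifford_sum) (use p in \<open>auto simp: oct_conj_mult_polar inner_e poly_below_commute[OF f x]\<close>)
  finally show ?thesis by (simp add: neg_Laplacian_def)
qed

lemma dir_deriv_neg_Laplacian:
  assumes f: "poly_below p d f" and x: "x \<in> paravec p" and j: "j \<le> p"
  shows "dir_deriv (\<e> j) (neg_Laplacian p f) x = neg_Laplacian p (dir_deriv (\<e> j) f) x"
proof -
  let ?D = "\<lambda>i. dir_deriv (\<e> i)"
  have "?D j (neg_Laplacian p f) x = (\<Sum>i\<le>p. - ?D j (?D i (?D i f)) x)"
    unfolding neg_Laplacian_alt[abs_def]
    by (rule dir_deriv_lincomb(2)[where L = "\<lambda>_. uminus"])
      (use assms in \<open>auto intro: bounded_linear_minus bounded_linear_ident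
        poly_below_differentiable[OF poly_below_dir_deriv'[OF poly_below_dir_deriv']]\<close>)
  also have "\<dots> = (\<Sum>i\<le>p. - ?D i (?D i (?D j f)) x)"
  proof (intro sum.cong refl arg_cong[where f = uminus])
    fix i assume "i \<in> {..p}"
    then have i: "i \<le> p" by simp
    have "?D j (?D i (?D i f)) x = ?D i (?D j (?D i f)) x"
      by (rule poly_below_commute[OF poly_below_dir_deriv'[OF f i] x j i])
    also have "\<dots> = ?D i (?D i (?D j f)) x"
      by (rule dir_deriv_cong[OF poly_below_commute[OF f _ j i] x i])
    finally show "?D j (?D i (?D i f)) x = ?D i (?D i (?D j f)) x" .
  qed
  finally show ?thesis by (simp add: neg_Laplacian_alt)
qed

lemma neg_Laplacian_lincomb:
  assumes I: "finite I" and L: "\<And>a. a \<in> I \<Longrightarrow> bounded_linear (L a)" 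
    and f: "\<And>a. a \<in> I \<Longrightarrow> poly_below p d (f a)" and x: "x \<in> paravec p"
  shows "neg_Laplacian p (\<lambda>x. \<Sum>a\<in>I. L a (f a x)) x = (\<Sum>a\<in>I. L a (neg_Laplacian p (f a) x))"
proof -
  let ?D = "\<lambda>i. dir_deriv (\<e> i)"
  have "?D i (?D i (\<lambda>x. \<Sum>a\<in>I. L a (f a x))) x = (\<Sum>a\<in>I. L a (?D i (?D i (f a)) x))" if i: "i \<le> p" for i
  proof -
    have "?D i (?D i (\<lambda>x. \<Sum>a\<in>I. L a (f a x))) x = ?D i (\<lambda>x. \<Sum>a\<in>I. L a (?D i (f a) x)) x"
      by (rule dir_deriv_cong[OF dir_deriv_lincomb(2)[OF I L poly_below_differentiable[OF f _ i]] x i])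
    also have "\<dots> = (\<Sum>a\<in>I. L a (?D i (?D i (f a)) x))"
      by (rule dir_deriv_lincomb(2)[OF I L poly_below_differentiable[OF poly_below_dir_deriv'[OF f i] x i]])
    finally show ?thesis .
  qed
  then have "neg_Laplacian p (\<lambda>x. \<Sum>a\<in>I. L a (f a x)) x = - (\<Sum>i\<le>p. \<Sum>a\<in>I. L a (?D i (?D i (f a)) x))"
    unfolding neg_Laplacian_def by (intro arg_cong[where f = uminus] sum.cong) auto
  also have "\<dots> = - (\<Sum>a\<in>I. \<Sum>i\<le>p. L a (?D i (?D i (f a)) x))" by (subst sum.swap) (rule refl)
  also have "\<dots> = (\<Sum>a\<in>I. L a (neg_Laplacian p (f a) x))"
    unfolding neg_Laplacian_def sum_negf[symmetric]
    by (intro sum.cong refl) (simp add: L linear_sum linear_neg bounded_linear.linear)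
  finally show ?thesis .
qed

lemma para_Dirac_neg_Laplacian:
  assumes f: "poly_below p d f" and x: "x \<in> paravec p"
  shows "neg_Laplacian p (para_Dirac p f) x = para_Dirac p (neg_Laplacian p f) x"
proof -
  have "neg_Laplacian p (para_Dirac p f) x = (\<Sum>i\<le>p. \<e> i \<odot> neg_Laplacian p (dir_deriv (\<e> i) f) x)"
    unfolding para_Dirac_def[abs_def]
    by (rule neg_Laplacian_lincomb[OF _ oct.bounded_linear_right]) (use f x in \<open>auto intro: poly_below_dir_deriv'\<close>)
  also have "\<dots> = para_Dirac p (neg_Laplacian p f) x"
    unfolding para_Dirac_def by (intro sum.cong refl) (simp add: dir_deriv_neg_Laplacian[OF f x])
  finally show ?thesis .
qed

lemma para_Dirac_neg_Laplacian_funpow: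
  assumes f: "poly_below p d f" 
  shows "x \<in> paravec p \<Longrightarrow> (neg_Laplacian p ^^ k) (para_Dirac p f) x = para_Dirac p ((neg_Laplacian p ^^ k) f) x"
proof (induction k arbitrary: x)
  case (Suc k)
  have "(neg_Laplacian p ^^ Suc k) (para_Dirac p f) x = neg_Laplacian p (para_Dirac p ((neg_Laplacian p ^^ k) f)) x"
    using neg_Laplacian_cong[OF Suc.IH Suc.prems] by simp
  also have "\<dots> = para_Dirac p ((neg_Laplacian p ^^ Suc k) f) x"
    using para_Dirac_neg_Laplacian[OF poly_below_neg_Laplacian_funpow'[OF f] Suc.prems] by simp
  finally show ?case .
qed simp

section \<open>The CK-extension\<close>

text \<open>The Taylor coefficients in \<open>r\<close> of the CK-extension on the slice of \<open>\<omega>\<close>, up to the factorials; even and odd orders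
  are merged into one sequence.\<close>

definition CK_coeff :: "nat \<Rightarrow> (octonion \<Rightarrow> octonion) \<Rightarrow> octonion \<Rightarrow> nat \<Rightarrow> octonion \<Rightarrow> octonion" where
  "CK_coeff p f \<omega> n x = (if even n then (neg_Laplacian p ^^ (n div 2)) f x
     else \<omega> \<odot> (neg_Laplacian p ^^ (n div 2)) (para_Dirac p f) x)"

lemma neg_Laplacian_funpow_eq_0:
  assumes "poly_below p d f" "d \<le> k" "x \<in> paravec p"
  shows "(neg_Laplacian p ^^ k) f x = 0"
  using poly_below_neg_Laplacian_funpow[OF assms(1), of k] assms by simp

lemma CK_series_eq_sum:
  assumes f: "poly_below p d f" and xp: "xp \<in> paravec p"
  shows "CK_series p f xp r \<omega> = (\<Sum>n<2*d. (r ^ n / fact n) *\<^sub>R CK_coeff p f \<omega> n xp)"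
proof -
  have 1: "(\<Sum>k. (r ^ (2*k) / fact (2*k)) *\<^sub>R (neg_Laplacian p ^^ k) f xp) = 
      (\<Sum>k<d. (r ^ (2*k) / fact (2*k)) *\<^sub>R (neg_Laplacian p ^^ k) f xp)"
    by (rule suminf_finite) (auto simp: neg_Laplacian_funpow_eq_0[OF f _ xp])
  have 2: "(\<Sum>k. (r ^ (2*k+1) / fact (2*k+1)) *\<^sub>R (neg_Laplacian p ^^ k) (para_Dirac p f) xp) = 
      (\<Sum>k<d. (r ^ (2*k+1) / fact (2*k+1)) *\<^sub>R (neg_Laplacian p ^^ k) (para_Dirac p f) xp)"
    by (rule suminf_finite) (auto simp: neg_Laplacian_funpow_eq_0[OF poly_below_para_Dirac[OF f] _ xp])
  have "(\<Sum>n<2*m. (r ^ n / fact n) *\<^sub>R CK_coeff p f \<omega> n xp) = 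
     (\<Sum>k<m. (r ^ (2*k) / fact (2*k)) *\<^sub>R (neg_Laplacian p ^^ k) f xp) +
     (\<omega> \<odot> (\<Sum>k<m. (r ^ (2*k+1) / fact (2*k+1)) *\<^sub>R (neg_Laplacian p ^^ k) (para_Dirac p f) xp))" for m
    by (induction m) (simp_all add: CK_coeff_def oct.add_right oct.zero_right oct.scaleR_right)
  then show ?thesis unfolding CK_series_def 1 2 by simp
qed

context
  fixes p d :: nat and f :: "octonion \<Rightarrow> octonion" and \<omega> :: octonion
  assumes p: "p \<le> 6" and f: "poly_below p d f" and \<omega>: "\<omega> \<in> slice_sphere p"
begin

lemma poly_below_CK_coeff: "poly_below p d (CK_coeff p f \<omega> n)"
proof (cases "even n")
  case True
  then show ?thesis using poly_below_neg_Laplacian_funpow'[OF f] by (simp add: CK_coeff_def[abs_def])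
next
  case False
  have "poly_below p d (\<lambda>x. \<Sum>a\<in>{()}. \<omega> \<odot> (neg_Laplacian p ^^ (n div 2)) (para_Dirac p f) x)"
    by (rule poly_below_lincomb[OF _ oct.bounded_linear_right])
      (auto intro: poly_below_neg_Laplacian_funpow' poly_below_para_Dirac f)
  then show ?thesis using False by (simp add: CK_coeff_def[abs_def])
qed

lemma CK_coeff_eq_0: "x \<in> paravec p \<Longrightarrow> CK_coeff p f \<omega> (2 * d) x = 0"
  by (simp add: CK_coeff_def neg_Laplacian_funpow_eq_0[OF f])

text \<open>From even to odd order this is \<open>\<omega> (\<omega> y) = - y\<close>. From odd to even order the factor \<open>\<omega>\<close> is moved
  to the front of the Dirac operator, which becomes its conjugate, and the factorization of the Laplacian
  applies.\<close>

lemma CK_coeff_recursion: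
  assumes x: "x \<in> paravec p"
  shows "para_Dirac p (CK_coeff p f \<omega> n) x + \<omega> \<odot> CK_coeff p f \<omega> (Suc n) x = 0"
proof -
  define k where "k = n div 2"
  define a where "a = (neg_Laplacian p ^^ k) f"
  define b where "b = (neg_Laplacian p ^^ k) (para_Dirac p f)"
  have a: "poly_below p d a" and b: "poly_below p d b"
    unfolding a_def b_def by (intro poly_below_neg_Laplacian_funpow' poly_below_para_Dirac f)+
  have b_eq: "b y = para_Dirac p a y" if "y \<in> paravec p" for y
    unfolding a_def b_def by (rule para_Dirac_neg_Laplacian_funpow[OF f that])
  show ?thesis
  proof (cases "even n")
    case True
    then have "CK_coeff p f \<omega> n = a" "CK_coeff p f \<omega> (Suc n) x = \<omega> \<odot> b x"
      by (auto simp: CK_coeff_def a_def b_def k_def)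
    then show ?thesis using b_eq[OF x] by (simp add: sphere_mult_twice[OF p \<omega>])
  next
    case False
    then have n: "CK_coeff p f \<omega> n = (\<lambda>x. \<omega> \<odot> b x)" "CK_coeff p f \<omega> (Suc n) x = neg_Laplacian p a x"
      by (auto simp: CK_coeff_def a_def b_def k_def)
    have D: "dir_deriv (\<e> i) (\<lambda>x. \<omega> \<odot> b x) x = \<omega> \<odot> dir_deriv (\<e> i) b x" if "i \<le> p" for i
      using dir_deriv_lincomb(2)[of "{()}" "\<lambda>_. (\<odot>) \<omega>" "\<lambda>_. b" x "\<e> i"]
        poly_below_differentiable[OF b x that] by (simp add: oct.bounded_linear_right)
    have "para_Dirac p (\<lambda>x. \<omega> \<odot> b x) x = \<omega> \<odot> conj_Dirac p b x"
      unfolding para_Dirac_def conj_Dirac_def oct.sum_right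
      by (intro sum.cong refl) (simp add: D mult_sphere_commute[OF p \<omega>])
    also have "conj_Dirac p b x = - neg_Laplacian p a x"
      using conj_Dirac_cong[OF b_eq x] conj_Dirac_para_Dirac[OF p a x] by simp
    finally show ?thesis unfolding n by (simp add: oct.minus_right)
  qed
qed

text \<open>For \<open>r < 0\<close> the point is decomposed with \<open>- r\<close> and \<open>- \<omega>\<close> instead; the signs cancel in every term.\<close>

lemma CK_on_slice:
  assumes xp: "xp \<in> paravec p"
  shows "CK p f (xp + r *\<^sub>R \<omega>) = (\<Sum>n<2*d. (r ^ n / fact n) *\<^sub>R CK_coeff p f \<omega> n xp)"
proof (cases "r \<ge> 0")
  case True
  then show ?thesis using CK_eq[OF p xp True \<omega>] CK_series_eq_sum[OF f xp] by simp
next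
  case False
  then have r: "- r \<ge> 0" by simp
  have "CK p f (xp + r *\<^sub>R \<omega>) = CK p f (xp + (- r) *\<^sub>R (- \<omega>))" by simp
  also have "\<dots> = (\<Sum>n<2*d. ((- r) ^ n / fact n) *\<^sub>R CK_coeff p f (- \<omega>) n xp)"
    unfolding CK_eq[OF p xp r uminus_sphere[OF p \<omega>]] by (rule CK_series_eq_sum[OF f xp])
  also have "\<dots> = (\<Sum>n<2*d. (r ^ n / fact n) *\<^sub>R CK_coeff p f \<omega> n xp)"
    by (intro sum.cong refl) (simp add: CK_coeff_def oct.minus_left)
  finally show ?thesis .
qed

lemma CK_derivative_along_slice:
  assumes xp: "xp \<in> paravec p" and i: "i \<le> p"
  shows "((\<lambda>t. CK p f ((xp + r *\<^sub>R \<omega>) + t *\<^sub>R \<e> i)) has_vector_derivative 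
    (\<Sum>n<2*d. (r ^ n / fact n) *\<^sub>R dir_deriv (\<e> i) (CK_coeff p f \<omega> n) xp)) (at 0)"
proof -
  have shift: "(xp + r *\<^sub>R \<omega>) + t *\<^sub>R \<e> i = (xp + t *\<^sub>R \<e> i) + r *\<^sub>R \<omega>" for t by simp
  have "CK p f ((xp + r *\<^sub>R \<omega>) + t *\<^sub>R \<e> i) = (\<Sum>n<2*d. (r ^ n / fact n) *\<^sub>R CK_coeff p f \<omega> n (xp + t *\<^sub>R \<e> i))" for t
    unfolding shift by (rule CK_on_slice[OF paravec_step[OF xp i]])
  then show ?thesis
    by (simp, intro has_vector_derivative_sum bounded_linear.has_vector_derivative[OF bounded_linear_scaleR_right]
        dir_deriv_works poly_below_differentiable[OF poly_below_CK_coeff xp i])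
qed

text \<open>Differentiating with respect to \<open>r\<close> shifts the coefficients; the index \<open>2 * d\<close> that enters has coefficient
  zero.\<close>

lemma CK_derivative_across_slice:
  assumes xp: "xp \<in> paravec p"
  shows "((\<lambda>t. CK p f ((xp + r *\<^sub>R \<omega>) + t *\<^sub>R \<omega>)) has_vector_derivative 
    (\<Sum>n<2*d. (r ^ n / fact n) *\<^sub>R CK_coeff p f \<omega> (Suc n) xp)) (at 0)"
proof -
  let ?c = "\<lambda>n. CK_coeff p f \<omega> n xp"
  have "(xp + r *\<^sub>R \<omega>) + t *\<^sub>R \<omega> = xp + (r + t) *\<^sub>R \<omega>" for t by (simp add: scaleR_add_left)
  then have CK: "CK p f ((xp + r *\<^sub>R \<omega>) + t *\<^sub>R \<omega>) = (\<Sum>n<2*d. ((r + t) ^ n / fact n) *\<^sub>R ?c n)" for t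
    by (simp only: CK_on_slice[OF xp])
  have D: "((\<lambda>t. (r + t) ^ n / fact n) has_vector_derivative (if n = 0 then 0 else r ^ (n - 1) / fact (n - 1))) (at 0)" for n
  proof (cases n)
    case (Suc m)
    have "((\<lambda>t. (r + t) ^ Suc m / fact (Suc m)) has_real_derivative
        real (Suc m) * (1 * (r + 0) ^ (Suc m - Suc 0)) / fact (Suc m)) (at 0)"
      by (intro DERIV_cdivide DERIV_power) (auto intro!: derivative_eq_intros)
    then show ?thesis
      using Suc by (simp add: has_real_derivative_iff_has_vector_derivative del: of_nat_Suc power_Suc)
  qed simp
  have "((\<lambda>t. CK p f ((xp + r *\<^sub>R \<omega>) + t *\<^sub>R \<omega>)) has_vector_derivative
      (\<Sum>n<2*d. (if n = 0 then 0 else r ^ (n - 1) / fact (n - 1)) *\<^sub>R ?c n)) (at 0)"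
    unfolding CK by (intro has_vector_derivative_sum bounded_linear.has_vector_derivative[OF bounded_linear_scaleR_left] D)
  also have "(\<Sum>n<2*d. (if n = 0 then 0 else r ^ (n - 1) / fact (n - 1)) *\<^sub>R ?c n) = 
      (\<Sum>n<Suc (2*d). (if n = 0 then 0 else r ^ (n - 1) / fact (n - 1)) *\<^sub>R ?c n)"
    using CK_coeff_eq_0[OF xp] by simp
  also have "\<dots> = (\<Sum>n<2*d. (r ^ n / fact n) *\<^sub>R ?c (Suc n))"
    by (subst sum.lessThan_Suc_shift) simp
  finally show ?thesis .
qed

end

lemma slice_monogenic_CK:
  assumes p: "p \<le> 6" and f: "poly_below p d f"
  shows "slice_monogenic p UNIV (CK p f)"
  unfolding slice_monogenic_def C1_on_slice_def
proof (intro conjI ballI)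
  fix \<omega> assume \<omega>: "\<omega> \<in> slice_sphere p"
  note along = CK_derivative_along_slice[OF p f \<omega>] and across = CK_derivative_across_slice[OF p f \<omega>]
  have coords: "x = para_part p x + (x \<bullet> \<omega>) *\<^sub>R \<omega>" if "x \<in> slice_space p \<omega>" for x
    using that slice_coordinates[OF p \<omega>] unfolding slice_space_def by auto
  note V = para_part_in_paravec[of p]
  have D_along: "dir_deriv (\<e> i) (CK p f) x = (\<Sum>n<2*d. ((x \<bullet> \<omega>) ^ n / fact n) *\<^sub>R dir_deriv (\<e> i) (CK_coeff p f \<omega> n) (para_part p x))"
    if "x \<in> slice_space p \<omega>" "i \<le> p" for x i
    using vector_derivative_at[OF along[OF V that(2), of x "x \<bullet> \<omega>"]] coords[OF that(1)] by (simp add: dir_deriv_def)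
  have D_across: "dir_deriv \<omega> (CK p f) x = (\<Sum>n<2*d. ((x \<bullet> \<omega>) ^ n / fact n) *\<^sub>R CK_coeff p f \<omega> (Suc n) (para_part p x))"
    if "x \<in> slice_space p \<omega>" for x
    using vector_derivative_at[OF across[OF V, of x "x \<bullet> \<omega>"]] coords[OF that(1)] by (simp add: dir_deriv_def)
  have para_cont: "continuous_on S (para_part p)" for S
    unfolding para_part_def crd_def by (intro continuous_intros)
  have cont: "continuous_on S (\<lambda>x. \<Sum>n<2*d. ((x \<bullet> \<omega>) ^ n / fact n) *\<^sub>R c n (para_part p x))"
    if "\<And>n. continuous_on (paravec p) (c n)" for S and c :: "nat \<Rightarrow> octonion \<Rightarrow> octonion"
    by (intro continuous_intros continuous_on_compose2[OF that para_cont]) (use V in auto)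
  {
    fix b assume b: "b \<in> insert \<omega> (\<e> ` {..p})"
    show "(\<lambda>t. CK p f (x + t *\<^sub>R b)) differentiable (at 0)" if "x \<in> UNIV \<inter> slice_space p \<omega>" for x
      using b along[OF V, of _ x "x \<bullet> \<omega>"] across[OF V, of x "x \<bullet> \<omega>"] coords[of x] that
      by (auto intro: differentiableI_vector)
    show "continuous_on (UNIV \<inter> slice_space p \<omega>) (dir_deriv b (CK p f))"
    proof (cases "b = \<omega>")
      case True
      then show ?thesis
        using cont[of "\<lambda>n. CK_coeff p f \<omega> (Suc n)" "slice_space p \<omega>"] poly_below_continuous[OF poly_below_CK_coeff[OF p f \<omega>]]
        by (simp add: D_across cong: continuous_on_cong)
    next
      case False
      then obtain i where "i \<le> p" "b = \<e> i" using b by auto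
      then show ?thesis
        using cont[of "\<lambda>n. dir_deriv (\<e> i) (CK_coeff p f \<omega> n)" "slice_space p \<omega>"]
          poly_below_continuous[OF poly_below_dir_deriv'[OF poly_below_CK_coeff[OF p f \<omega>]]]
        by (simp add: D_along cong: continuous_on_cong)
    qed
  }
  fix x assume "x \<in> UNIV \<inter> slice_space p \<omega>"
  then have x: "x \<in> slice_space p \<omega>" by simp
  let ?C = "CK_coeff p f \<omega>" and ?r = "x \<bullet> \<omega>" and ?xp = "para_part p x"
  have "(\<Sum>i\<le>p. \<e> i \<odot> dir_deriv (\<e> i) (CK p f) x) = (\<Sum>i\<le>p. \<Sum>n<2*d. (?r ^ n / fact n) *\<^sub>R (\<e> i \<odot> dir_deriv (\<e> i) (?C n) ?xp))"
    by (intro sum.cong refl) (simp add: D_along[OF x] oct.sum_right oct.scaleR_right)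
  also have "\<dots> = (\<Sum>n<2*d. (?r ^ n / fact n) *\<^sub>R para_Dirac p (?C n) ?xp)"
    by (subst sum.swap) (simp add: para_Dirac_def scaleR_sum_right)
  finally have "(\<Sum>i\<le>p. \<e> i \<odot> dir_deriv (\<e> i) (CK p f) x) + \<omega> \<odot> dir_deriv \<omega> (CK p f) x =
      (\<Sum>n<2*d. (?r ^ n / fact n) *\<^sub>R (para_Dirac p (?C n) ?xp + \<omega> \<odot> ?C (Suc n) ?xp))"
    by (simp only:) (simp add: D_across[OF x] oct.sum_right oct.scaleR_right scaleR_add_right sum.distrib)
  also have "\<dots> = 0" using CK_coeff_recursion[OF p f \<omega> V] by simp
  finally show "(\<Sum>i\<le>p. \<e> i \<odot> dir_deriv (\<e> i) (CK p f) x) + \<omega> \<odot> dir_deriv \<omega> (CK p f) x = 0" .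
qed (auto intro: connected_UNIV)

text \<open>On the paravectors the CK-extension is the series for \<open>r = 0\<close> and \<open>\<omega> = 0\<close>.\<close>

lemma CK_extends:
  assumes p: "p \<le> 6" and f: "poly_below p d f" and x: "x \<in> paravec p"
  shows "CK p f x = f x"
proof -
  (* The degree bound is raised so that the sum contains the term of order 0 even if d = 0. *)
  have f': "poly_below p (Suc d) f" using f by (rule poly_below_Suc)
  have "CK p f x = (\<Sum>n<2 * Suc d. (0 ^ n / fact n) *\<^sub>R CK_coeff p f 0 n x)"
    using CK_series_eq_sum[OF f' x] by (simp only: CK_def para_part_paravec[OF p x]) simp
  also have "\<dots> = (\<Sum>n<2 * Suc d. if n = 0 then f x else 0)"
    by (intro sum.cong refl) (simp add: CK_coeff_def)
  also have "\<dots> = f x" by simp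
  finally show ?thesis .
qed

theorem theorem6p8:
  fixes p :: nat and f0 :: "octonion \<Rightarrow> octonion"
  assumes "p \<le> 6"
    and "oct_polynomial p f0"
  shows "slice_monogenic p UNIV (CK p f0) \<and>
         (\<forall>x\<in>paravec p. CK p f0 x = f0 x) \<and>
         (\<forall>g. slice_monogenic p UNIV g \<and> (\<forall>x\<in>paravec p. g x = f0 x) \<longrightarrow> g = CK p f0)"
proof -
  obtain d where d: "poly_below p d f0" by (rule oct_polynomial_poly_below[OF assms])
  have mono: "slice_monogenic p UNIV (CK p f0)" by (rule slice_monogenic_CK[OF assms(1) d])
  have extends: "CK p f0 x = f0 x" if "x \<in> paravec p" for x
    by (rule CK_extends[OF assms(1) d that])
  have "g = CK p f0" if "slice_monogenic p UNIV g" "\<forall>x\<in>paravec p. g x = f0 x" for g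
    by (rule ext, rule slice_monogenic_eqI[OF assms(1) that(1) mono]) (use that(2) extends in simp)
  then show ?thesis using mono extends by blast
qed

end
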